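(* Let $n,k$ be integers with $n/2<k<n$. Then \[ K_S(n,k)=K_L(n,k)=E_S(n,k)=E_L(n,k)=2(n-k)-B(n-k), \] and the same equalities hold for the corresponding four numbers defined under the additional knowledge that at least one spy is present. Moreover \[ N_S(n,k)=N_L(n,k)=\widetilde{N}_S(n,k)=\widetilde{N}_L(n,k)=2(n-k)-B(n-k)+1, \] with the exception that $\widetilde{N}_L(n,k)=2(n-k)-B(n-k)$ when $n=2^{e+1}+1$ and $k=2^e+1$ for some $e\in\mathbf{N}$.
   Context: There are $n$ people, numbered $1,\dots,n$, each either a knight or a spy; at least $k$ are knights, where $n/2<k<n$. The only permitted questions have the form "Person $x$, is Person $y$ a spy?" with $x\ne y$, answered "yes" or "no" by Person $x$; questions are adaptive. Knights always tell the truth. Subscript $L$ refers to the model where spies always lie; subscript $S$ to the model where spies are unconstrained (may answer truthfully or falsely as they see fit). A number of questions is "necessary and sufficient" for a task if some adaptive strategy accomplishes it within that many questions in every consistent situation, and no strategy with fewer does. $K_L(n,k)$, $K_S(n,k)$: number of questions necessary and sufficient to identify (with certainty) some person who is a knight. $E_L(n,k)$, $E_S(n,k)$: number necessary and sufficient to determine with certainty the identity (knight or spy) of at least one person. $N_L(n,k)$, $N_S(n,k)$: number necessary and sufficient to determine the identity of Person $1$. $\widetilde{N}_L(n,k)$, $\widetilde{N}_S(n,k)$: the same as $N_L,N_S$ but under the additional knowledge that at least one spy is present. For $s\in\mathbf{N}$, $B(s)$ denotes the number of $1$s in the binary expansion of $s$. *)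

theory Defs
  imports "HOL-Library.Extended_Nat"
begin

text \<open>
  A situation is the set of knights among the people \<open>1, \<dots>, n\<close>. A spy model tells which answers
  to the question "Person \<open>x\<close>, is Person \<open>y\<close> a spy?" are possible in a situation, where \<open>True\<close>
  is the answer "yes". In the model of unconstrained spies a spy may even answer the same
  question differently on different occasions.
\<close>

type_synonym spy_model = "nat set \<Rightarrow> nat \<Rightarrow> nat \<Rightarrow> bool \<Rightarrow> bool"

definition lying_spies :: spy_model where
  "lying_spies A x y a \<longleftrightarrow> (if x \<in> A then a = (y \<notin> A) else a \<noteq> (y \<notin> A))"

definition unconstrained_spies :: spy_model where
  "unconstrained_spies A x y a \<longleftrightarrow> (x \<in> A \<longrightarrow> a = (y \<notin> A))"

definition situations :: "nat \<Rightarrow> nat \<Rightarrow> nat set set" where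
  "situations n k = {A. A \<subseteq> {1..n} \<and> k \<le> card A}"

definition situations_with_spy :: "nat \<Rightarrow> nat \<Rightarrow> nat set set" where
  "situations_with_spy n k = {A \<in> situations n k. \<exists>x\<in>{1..n}. x \<notin> A}"

text \<open>
  An adaptive strategy is a decision tree: \<open>Ask x y s t\<close> asks Person \<open>x\<close> whether Person \<open>y\<close> is a
  spy and continues with \<open>s\<close> on "yes" and with \<open>t\<close> on "no".
\<close>

datatype 'r strategy = Announce 'r | Ask nat nat "'r strategy" "'r strategy"

primrec permitted :: "nat \<Rightarrow> 'r strategy \<Rightarrow> bool" where
  "permitted n (Announce r) \<longleftrightarrow> True"
| "permitted n (Ask x y s t) \<longleftrightarrow>
     x \<in> {1..n} \<and> y \<in> {1..n} \<and> x \<noteq> y \<and> permitted n s \<and> permitted n t"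

text \<open>
  \<open>run M A s r m\<close>: in situation \<open>A\<close>, some course of answers possible in the model \<open>M\<close> makes the
  strategy \<open>s\<close> announce \<open>r\<close> after exactly \<open>m\<close> questions.
\<close>

inductive run :: "spy_model \<Rightarrow> nat set \<Rightarrow> 'r strategy \<Rightarrow> 'r \<Rightarrow> nat \<Rightarrow> bool"
  for M A where
  announce: "run M A (Announce r) r 0"
| yes: "M A x y True \<Longrightarrow> run M A s r m \<Longrightarrow> run M A (Ask x y s t) r (Suc m)"
| no: "M A x y False \<Longrightarrow> run M A t r m \<Longrightarrow> run M A (Ask x y s t) r (Suc m)"

definition accomplishes ::
  "spy_model \<Rightarrow> nat set set \<Rightarrow> (nat set \<Rightarrow> 'r \<Rightarrow> bool) \<Rightarrow> 'r strategy \<Rightarrow> nat \<Rightarrow> bool" where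
  "accomplishes M \<Omega> correct s q \<longleftrightarrow>
     (\<forall>A\<in>\<Omega>. \<forall>r m. run M A s r m \<longrightarrow> correct A r \<and> m \<le> q)"

text \<open>The value is \<open>\<infinity>\<close> if no strategy accomplishes the task.\<close>

definition questions_needed ::
  "nat \<Rightarrow> spy_model \<Rightarrow> nat set set \<Rightarrow> (nat set \<Rightarrow> 'r \<Rightarrow> bool) \<Rightarrow> enat" where
  "questions_needed n M \<Omega> correct =
     Inf {enat q | q. \<exists>s. permitted n s \<and> accomplishes M \<Omega> correct s q}"

definition is_knight :: "nat set \<Rightarrow> nat \<Rightarrow> bool" where
  "is_knight A x \<longleftrightarrow> x \<in> A"

text \<open>The announcement \<open>(x, b)\<close> claims that Person \<open>x\<close> is a knight if \<open>b\<close> holds, else a spy.\<close>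

definition is_identity :: "nat \<Rightarrow> nat set \<Rightarrow> nat \<times> bool \<Rightarrow> bool" where
  "is_identity n A = (\<lambda>(x, b). x \<in> {1..n} \<and> b = (x \<in> A))"

definition is_identity_of :: "nat \<Rightarrow> nat set \<Rightarrow> bool \<Rightarrow> bool" where
  "is_identity_of x A b \<longleftrightarrow> b = (x \<in> A)"

definition K_L :: "nat \<Rightarrow> nat \<Rightarrow> enat" where
  "K_L n k = questions_needed n lying_spies (situations n k) is_knight"

definition K_S :: "nat \<Rightarrow> nat \<Rightarrow> enat" where
  "K_S n k = questions_needed n unconstrained_spies (situations n k) is_knight"

definition E_L :: "nat \<Rightarrow> nat \<Rightarrow> enat" where
  "E_L n k = questions_needed n lying_spies (situations n k) (is_identity n)"

definition E_S :: "nat \<Rightarrow> nat \<Rightarrow> enat" where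
  "E_S n k = questions_needed n unconstrained_spies (situations n k) (is_identity n)"

definition N_L :: "nat \<Rightarrow> nat \<Rightarrow> enat" where
  "N_L n k = questions_needed n lying_spies (situations n k) (is_identity_of 1)"

definition N_S :: "nat \<Rightarrow> nat \<Rightarrow> enat" where
  "N_S n k = questions_needed n unconstrained_spies (situations n k) (is_identity_of 1)"

definition K_L_tilde :: "nat \<Rightarrow> nat \<Rightarrow> enat" where
  "K_L_tilde n k = questions_needed n lying_spies (situations_with_spy n k) is_knight"

definition K_S_tilde :: "nat \<Rightarrow> nat \<Rightarrow> enat" where
  "K_S_tilde n k = questions_needed n unconstrained_spies (situations_with_spy n k) is_knight"

definition E_L_tilde :: "nat \<Rightarrow> nat \<Rightarrow> enat" where
  "E_L_tilde n k = questions_needed n lying_spies (situations_with_spy n k) (is_identity n)"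

definition E_S_tilde :: "nat \<Rightarrow> nat \<Rightarrow> enat" where
  "E_S_tilde n k = questions_needed n unconstrained_spies (situations_with_spy n k) (is_identity n)"

definition N_L_tilde :: "nat \<Rightarrow> nat \<Rightarrow> enat" where
  "N_L_tilde n k = questions_needed n lying_spies (situations_with_spy n k) (is_identity_of 1)"

definition N_S_tilde :: "nat \<Rightarrow> nat \<Rightarrow> enat" where
  "N_S_tilde n k =
     questions_needed n unconstrained_spies (situations_with_spy n k) (is_identity_of 1)"

definition binary_ones :: "nat \<Rightarrow> nat" where
  "binary_ones s = card {i. bit s i}"

end

theory Submission
  imports Defs "HOL-Computational_Algebra.Polynomial_FPS" "HOL-Computational_Algebra.Primes"
begin

text \<open>
  Write \<open>s = n - k\<close> and \<open>B\<close> for the number of binary ones. For the upper bounds, keep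
  groups whose sizes are powers of two and in which all members are spies as soon as a chosen root
  is one, and let the roots of equal groups question each other: an accusation discards
  both groups, otherwise they merge. Starting from \<open>2 * s + 1\<close> people, the number of
  questions is at most \<open>2 * s + 1\<close> minus the number of powers of two left,
  so at most \<open>2 * s + 1 - B (2 * s + 1)\<close>; then all sizes are distinct and the largest group
  is led by a knight.

  For the lower bounds let spies lie, so that answers only compare people, and give each set of
  knights the sign \<open>(-1) ^ j\<close> and the weight \<open>[X ^ (s - j)] (1 - X) ^ - (n - 2 * s)\<close>, where
  \<open>j\<close> is the number of spies. The total weight is \<open>[X ^ s] (1 - X) ^ (2 * s)\<close>, a central
  binomial coefficient up to sign, which is divisible by \<open>2\<close> exactly \<open>B s\<close> times. On the
  other hand, the weights at a leaf with \<open>C \<ge> n - q\<close> components at which some identity is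
  known add up to a multiple of \<open>2 ^ (C - (n - 2 * s))\<close>. Hence \<open>q \<ge> 2 * s - B s\<close>.
  For Person 1, restrict the sum to the sets that contain 1: this halves the total,
  but the divisibility at the leaves persists.
\<close>

section \<open>Binary ones and central binomial coefficients\<close>

lemma finite_bits: "finite {i. bit (m::nat) i}"
proof (rule finite_subset)
  show "{i. bit m i} \<subseteq> {..<m}"
    using bit_nat_def[of m] by (auto simp: bit_iff_odd)
      (metis even_zero div_less less_exp not_less order_less_le_trans)
qed simp

lemma binary_ones_rec: "binary_ones m = binary_ones (m div 2) + m mod 2"
proof -
  have "{i. bit m i} = Suc ` {i. bit (m div 2) i} \<union> (if odd m then {0} else {})"
  proof (rule set_eqI)
    fix i show "i \<in> {i. bit m i} \<longleftrightarrow> i \<in> Suc ` {i. bit (m div 2) i} \<union> (if odd m then {0} else {})"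
      by (cases i) (auto simp: bit_0 bit_Suc)
  qed
  then show ?thesis
    using finite_bits[of "m div 2"]
    by (auto simp: binary_ones_def card_Un_disjoint card_image odd_iff_mod_2_eq_one even_iff_mod_2_eq_zero
        simp del: One_nat_def)
qed

lemma binary_ones_0 [simp]: "binary_ones 0 = 0"
  by (simp add: binary_ones_def)

lemma binary_ones_double [simp]: "binary_ones (2 * m) = binary_ones m"
  by (subst binary_ones_rec) simp

lemma binary_ones_Suc_double [simp]: "binary_ones (Suc (2 * m)) = Suc (binary_ones m)"
  by (subst binary_ones_rec) simp

lemma binary_ones_power [simp]: "binary_ones (2 ^ i) = 1"
proof (induction i)
  case 0
  show ?case using binary_ones_Suc_double[of 0] by simp
qed simp

text \<open>A carry turns ones into zeros and creates only one new one, where it stops. Halving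
  reduces \<open>i\<close> to 0, where an odd \<open>m\<close> passes the carry on to its
  half.\<close>

lemma binary_ones_add_power_le: "binary_ones (m + 2 ^ i) \<le> Suc (binary_ones m)"
proof (induction i arbitrary: m)
  case 0
  show ?case
  proof (induction m rule: less_induct)
    case (less m)
    show ?case
    proof (cases "even m")
      case True
      then show ?thesis by (auto elim!: evenE)
    next
      case False
      then obtain j where j: "m = Suc (2 * j)" by (auto elim!: oddE)
      have "binary_ones (m + 2 ^ 0) = binary_ones (2 * Suc j)" using j by simp
      also have "\<dots> = binary_ones (j + 2 ^ 0)" by (subst binary_ones_double) simp
      also have "\<dots> \<le> Suc (binary_ones j)" using less[of j] j by simp
      finally show ?thesis using j by simp
    qed
  qed
next
  case (Suc i)
  have 1: "(m + 2 ^ Suc i) div 2 = m div 2 + 2 ^ i" "(m + 2 ^ Suc i) mod 2 = m mod 2"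
    by simp_all
  show ?case
    using Suc[of "m div 2"] binary_ones_rec[of "m + 2 ^ Suc i"] binary_ones_rec[of m]
    unfolding 1 by linarith
qed

text \<open>Guarantees that the truncated subtractions in the question counts below are
  genuine.\<close>

lemma binary_ones_sum_powers_le:
  assumes "finite R"
  shows "binary_ones (\<Sum>r\<in>R. 2 ^ e r) \<le> card R"
  using assms
proof (induction R rule: finite_induct)
  case (insert x R)
  then show ?case
    using binary_ones_add_power_le[of "\<Sum>r\<in>R. 2 ^ e r" "e x"] by (simp add: add.commute)
qed simp

lemma binary_ones_pos: "0 < m \<Longrightarrow> 0 < binary_ones m"
proof (induction m rule: less_induct)
  case (less m)
  then show ?case
    using binary_ones_rec[of m] by (cases "m div 2 = 0") (auto simp: div_eq_0_iff less_2_cases_iff)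
qed

lemma binary_ones_eq_1_imp_power: "binary_ones m = 1 \<Longrightarrow> \<exists>e. m = 2 ^ e"
proof (induction m rule: less_induct)
  case (less m)
  show ?case
  proof (cases "even m")
    case True
    then obtain j where j: "m = 2 * j" by (auto elim!: evenE)
    then have "0 < j" using less.prems by (cases j) auto
    then obtain e where "j = 2 ^ e" using less j by fastforce
    then show ?thesis using j by (intro exI[of _ "Suc e"]) simp
  next
    case False
    then obtain j where j: "m = Suc (2 * j)" by (auto elim!: oddE)
    then have "binary_ones j = 0" using less.prems by simp
    then have "j = 0" using binary_ones_pos[of j] by linarith
    then show ?thesis using j by (intro exI[of _ 0]) simp
  qed
qed

section \<open>Powers of two in central binomial coefficients\<close>

text \<open>The odd factors do not count, and the even ones multiply to
  \<open>2 ^ m * fact m\<close>.\<close>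

lemma multiplicity_2_fact_double: "multiplicity 2 (fact (2 * m) :: nat) = m + multiplicity 2 (fact m :: nat)"
proof (induction m)
  case (Suc m)
  have "(fact (2 * Suc m) :: nat) = 2 * Suc m * (Suc (2 * m) * fact (2 * m))"
    by (simp add: algebra_simps)
  moreover have "multiplicity 2 (Suc (2 * m)) = 0"
    by (intro not_dvd_imp_multiplicity_0) simp
  ultimately have "multiplicity 2 (fact (2 * Suc m) :: nat)
      = 1 + multiplicity 2 (Suc m) + multiplicity 2 (fact (2 * m) :: nat)"
    by (simp add: prime_elem_multiplicity_mult_distrib prime_elem_nat_iff del: fact_Suc mult_Suc mult_Suc_right)
  also have "\<dots> = Suc m + (multiplicity 2 (Suc m) + multiplicity 2 (fact m :: nat))"
    using Suc by simp
  also have "multiplicity 2 (Suc m) + multiplicity 2 (fact m :: nat) = multiplicity 2 (fact (Suc m) :: nat)"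
    by (simp add: prime_elem_multiplicity_mult_distrib prime_elem_nat_iff del: mult_Suc of_nat_Suc)
  finally show ?case .
qed simp

text \<open>Legendre's formula for the prime 2, by halving \<open>m\<close>.\<close>

lemma multiplicity_2_fact: "multiplicity 2 (fact m :: nat) + binary_ones m = m"
proof (induction m rule: less_induct)
  case (less m)
  show ?case
  proof (cases "m = 0")
    case False
    define j where "j = m div 2"
    have IH: "multiplicity 2 (fact j :: nat) + binary_ones j = j"
      using less[of j] False by (simp add: j_def)
    show ?thesis
    proof (cases "even m")
      case True
      then have m: "m = 2 * j" by (simp add: j_def)
      show ?thesis using IH by (simp add: m multiplicity_2_fact_double del: fact_double)
    next
      case False
      then have m: "m = Suc (2 * j)" by (simp add: j_def)
      have "multiplicity 2 (Suc (2 * j)) = 0"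
        by (intro not_dvd_imp_multiplicity_0) simp
      then have "multiplicity 2 (fact m :: nat) = multiplicity 2 (fact (2 * j) :: nat)"
        unfolding m fact_Suc
        by (simp add: prime_elem_multiplicity_mult_distrib prime_elem_nat_iff
            del: mult_Suc of_nat_Suc fact_double)
      then show ?thesis using IH by (simp add: m multiplicity_2_fact_double del: fact_Suc)
    qed
  qed simp
qed

lemma multiplicity_2_central_binomial: "multiplicity 2 ((2 * m) choose m) = binary_ones m"
proof -
  have "fact m * fact m * ((2 * m) choose m) = (fact (2 * m) :: nat)"
    using binomial_fact_lemma[of m "2 * m"] by simp
  then have "multiplicity 2 (fact m * fact m * ((2 * m) choose m)) = multiplicity 2 (fact (2 * m) :: nat)"
    by (rule arg_cong)
  then have "multiplicity 2 (fact m :: nat) + multiplicity 2 (fact m :: nat)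
      + multiplicity 2 ((2 * m) choose m) = m + multiplicity 2 (fact m :: nat)"
    unfolding multiplicity_2_fact_double
    by (simp add: prime_elem_multiplicity_mult_distrib prime_elem_nat_iff)
  then show ?thesis using multiplicity_2_fact[of m] by linarith
qed

lemma not_power_dvd_central_binomial:
  assumes "binary_ones m < j"
  shows "\<not> 2 ^ j dvd ((2 * m) choose m)"
proof
  assume "2 ^ j dvd ((2 * m) choose m)"
  then have "j \<le> multiplicity 2 ((2 * m) choose m)"
    by (intro multiplicity_geI) auto
  then show False using assms by (simp add: multiplicity_2_central_binomial)
qed

section \<open>Strategies\<close>

inductive_simps run_Announce_iff [simp]: "run M A (Announce r) r' m"
inductive_simps run_Ask_iff: "run M A (Ask x y s t) r m"

lemma accomplishes_Announce [simp]:
  "accomplishes M \<Omega> correct (Announce r) q \<longleftrightarrow> (\<forall>A\<in>\<Omega>. correct A r)"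
  by (auto simp: accomplishes_def)

lemma accomplishes_Ask [simp]:
  "accomplishes M \<Omega> correct (Ask x y s t) (Suc q) \<longleftrightarrow>
     accomplishes M {A \<in> \<Omega>. M A x y True} correct s q \<and>
     accomplishes M {A \<in> \<Omega>. M A x y False} correct t q"
proof -
  have *: "(\<forall>m. run M A (Ask x y s t) r m \<longrightarrow> correct A r \<and> m \<le> Suc q) \<longleftrightarrow>
      (\<forall>m. (M A x y True \<longrightarrow> run M A s r m \<longrightarrow> correct A r \<and> m \<le> q) \<and>
           (M A x y False \<longrightarrow> run M A t r m \<longrightarrow> correct A r \<and> m \<le> q))" for A r
    unfolding run_Ask_iff by (auto simp: all_conj_distrib)
  show ?thesis unfolding accomplishes_def * by blast
qed

lemma accomplishes_mono:
  "accomplishes M \<Omega> correct s q \<Longrightarrow> \<Omega>' \<subseteq> \<Omega> \<Longrightarrow> q \<le> q' \<Longrightarrow> accomplishes M \<Omega>' correct s q'"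
  unfolding accomplishes_def by (meson le_trans subsetD)

lemma run_lying_imp_run_unconstrained:
  "run lying_spies A s r m \<Longrightarrow> run unconstrained_spies A s r m"
  by (induction rule: run.induct)
     (auto intro: run.intros simp: lying_spies_def unconstrained_spies_def split: if_splits)

lemma accomplishes_unconstrained_imp_lying:
  "accomplishes unconstrained_spies \<Omega> correct s q \<Longrightarrow> accomplishes lying_spies \<Omega> correct s q"
  unfolding accomplishes_def by (meson run_lying_imp_run_unconstrained)

text \<open>Both models allow at least one answer to every question, so no strategy gets stuck and a
  bound on the number of questions is never met vacuously.\<close>

lemma run_exists:
  assumes "M \<in> {lying_spies, unconstrained_spies}"
  shows "\<exists>r m. run M A s r m"
proof (induction s)
  case (Announce r)
  show ?case by auto
next
  case (Ask x y s t)
  have "M A x y True \<or> M A x y False"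
    using assms by (auto simp: lying_spies_def unconstrained_spies_def)
  then show ?case using Ask.IH by (meson run.yes run.no)
qed

lemma accomplishes_Ask_0:
  assumes "M \<in> {lying_spies, unconstrained_spies}" "accomplishes M \<Omega> correct (Ask x y s t) 0"
  shows "\<Omega> = {}"
proof (rule ccontr)
  assume "\<Omega> \<noteq> {}"
  then obtain A where "A \<in> \<Omega>" by blast
  moreover obtain r m where "run M A (Ask x y s t) r m" using run_exists[OF assms(1)] by metis
  ultimately have "m \<le> 0" using assms(2) unfolding accomplishes_def by blast
  with \<open>run M A (Ask x y s t) r m\<close> show False by (auto simp: run_Ask_iff)
qed

lemma questions_needed_le:
  "permitted n s \<Longrightarrow> accomplishes M \<Omega> correct s q \<Longrightarrow> questions_needed n M \<Omega> correct \<le> enat q"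
  unfolding questions_needed_def by (rule Inf_lower) blast

lemma questions_needed_ge:
  assumes "\<And>s q. permitted n s \<Longrightarrow> accomplishes M \<Omega> correct s q \<Longrightarrow> v \<le> q"
  shows "enat v \<le> questions_needed n M \<Omega> correct"
  unfolding questions_needed_def by (rule Inf_greatest) (use assms in auto)

section \<open>Surplus of knights and merging of groups\<close>

text \<open>
  A root \<open>r\<close> of weight \<open>2 ^ e r\<close> stands for a group of that many people who are all spies if
  \<open>r\<close> is one.
\<close>

definition surplus :: "(nat \<Rightarrow> nat) \<Rightarrow> nat set \<Rightarrow> nat set \<Rightarrow> int" where
  "surplus e R A = (\<Sum>r\<in>R. if r \<in> A then 2 ^ e r else - (2 ^ e r))"

lemma surplus_remove:
  "finite R \<Longrightarrow> x \<in> R \<Longrightarrow> surplus e R A = (if x \<in> A then 2 ^ e x else - (2 ^ e x)) + surplus e (R - {x}) A"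
  unfolding surplus_def by (rule sum.remove)

lemma surplus_cong: "(\<And>r. r \<in> R \<Longrightarrow> e r = e' r) \<Longrightarrow> surplus e R A = surplus e' R A"
  unfolding surplus_def by (rule sum.cong) auto

text \<open>Two groups of equal weight whose roots are not both knights contribute at most 0
  together.\<close>

lemma surplus_discard:
  assumes "finite R" "x \<in> R" "y \<in> R" "x \<noteq> y" "e x = e y" "\<not> (x \<in> A \<and> y \<in> A)"
  shows "surplus e R A \<le> surplus e (R - {x, y}) A"
proof -
  have "surplus e R A = (if x \<in> A then 2 ^ e x else - (2 ^ e x))
      + ((if y \<in> A then 2 ^ e y else - (2 ^ e y)) + surplus e (R - {x} - {y}) A)"
    using assms by (simp add: surplus_remove[of R x] surplus_remove[of "R - {x}" y])
  then show ?thesis using assms by (auto simp: Diff_insert2 [symmetric] insert_commute)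
qed

text \<open>If the roots differ in kind, \<open>y\<close> is the knight and the contribution rises
  from 0 to the doubled weight; otherwise it is unchanged.\<close>

lemma surplus_merge:
  assumes "finite R" "x \<in> R" "y \<in> R" "x \<noteq> y" "e x = e y" "x \<in> A \<longrightarrow> y \<in> A"
  shows "surplus e R A \<le> surplus (e(y := Suc (e y))) (R - {x}) A"
proof -
  have "surplus (e(y := Suc (e y))) (R - {x}) A
      = (if y \<in> A then 2 ^ Suc (e y) else - (2 ^ Suc (e y))) + surplus e (R - {x} - {y}) A"
    using assms by (subst surplus_remove[of _ y]) (auto intro!: surplus_cong)
  moreover have "surplus e R A = (if x \<in> A then 2 ^ e x else - (2 ^ e x))
      + ((if y \<in> A then 2 ^ e y else - (2 ^ e y)) + surplus e (R - {x} - {y}) A)"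
    using assms by (simp add: surplus_remove[of R x] surplus_remove[of "R - {x}" y])
  ultimately show ?thesis using assms by auto
qed

lemma total_weight_discard:
  fixes e :: "nat \<Rightarrow> nat"
  assumes "finite R" "x \<in> R" "y \<in> R" "x \<noteq> y" "e x = e y"
  shows "(\<Sum>r\<in>R. 2 ^ e r) = (\<Sum>r\<in>R - {x, y}. 2 ^ e r) + (2::nat) ^ Suc (e x)"
proof -
  have "R - {x} - {y} = R - {x, y}" by auto
  then show ?thesis
    using assms by (simp add: sum.remove[of R x] sum.remove[of "R - {x}" y])
qed

lemma total_weight_merge:
  fixes e :: "nat \<Rightarrow> nat"
  assumes "finite R" "x \<in> R" "y \<in> R" "x \<noteq> y" "e x = e y"
  shows "(\<Sum>r\<in>R - {x}. 2 ^ (e(y := Suc (e y))) r) = (\<Sum>r\<in>R. (2::nat) ^ e r)"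
proof -
  have "R - {x} - {y} = R - {x, y}" by auto
  moreover have "(\<Sum>r\<in>R - {x, y}. 2 ^ (e(y := Suc (e y))) r) = (\<Sum>r\<in>R - {x, y}. (2::nat) ^ e r)"
    by (rule sum.cong) auto
  ultimately show ?thesis
    using assms total_weight_discard[of R x y e] by (simp add: sum.remove[of "R - {x}" y])
qed

lemma sum_distinct_powers_less:
  assumes "finite R" "inj_on e R" "\<And>r. r \<in> R \<Longrightarrow> e r < (m::nat)"
  shows "(\<Sum>r\<in>R. (2::int) ^ e r) < 2 ^ m"
proof -
  have "(\<Sum>r\<in>R. (2::int) ^ e r) = (\<Sum>i\<in>e ` R. 2 ^ i)"
    using assms by (simp add: sum.reindex)
  also have "\<dots> \<le> (\<Sum>i<m. 2 ^ i)"
    by (rule sum_mono2) (use assms in auto)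
  also have "\<dots> < 2 ^ m"
    by (induction m) auto
  finally show ?thesis .
qed

text \<open>The largest of distinct powers of two exceeds the sum of the others, so the surplus
  would be negative if its root were a spy. Asking only for a surplus of 0 leaves room to count
  Person 1 separately.\<close>

lemma heaviest_root_is_knight:
  assumes "finite R" "inj_on e R" "R \<noteq> {}"
  obtains x where "x \<in> R" "\<And>A. 0 \<le> surplus e R A \<Longrightarrow> x \<in> A"
proof -
  have "Max (e ` R) \<in> e ` R" using assms by simp
  then obtain x where x: "x \<in> R" "e x = Max (e ` R)" by force
  have less: "e r < e x" if "r \<in> R - {x}" for r
    using that assms x by (metis Diff_iff Max_ge finite_imageI imageI inj_onD insertI1 order_neq_le_trans)
  have "x \<in> A" if "0 \<le> surplus e R A" for A
  proof (rule ccontr)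
    assume "x \<notin> A"
    then have "surplus e R A = - (2 ^ e x) + surplus e (R - {x}) A"
      using assms x by (simp add: surplus_remove[of R x])
    also have "surplus e (R - {x}) A \<le> (\<Sum>r\<in>R - {x}. 2 ^ e r)"
      unfolding surplus_def by (rule sum_mono) (auto intro: order_trans[of _ 0])
    also have "\<dots> < 2 ^ e x"
      using assms less by (intro sum_distinct_powers_less) (auto intro: inj_on_subset)
    finally show False using that by simp
  qed
  then show ?thesis using x that by blast
qed

text \<open>
  As long as two roots have equal weight, ask one about the other. The answer "yes" shows that one
  of them is a spy, and both are dropped; after the answer "no" the first is absorbed by the second.
  The surplus never decreases, so \<open>\<theta>\<close> remains a lower bound for it.
\<close>

lemma merging_strategy:
  fixes \<theta> :: "nat set \<Rightarrow> int"
  assumes "finite R" "R \<subseteq> {1..n}"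
    and "\<And>A. A \<in> \<Omega> \<Longrightarrow> \<theta> A \<le> surplus e R A"
    and last: "\<And>e R' \<Omega>. R' \<subseteq> R \<Longrightarrow> inj_on e R' \<Longrightarrow> (\<And>A. A \<in> \<Omega> \<Longrightarrow> \<theta> A \<le> surplus e R' A) \<Longrightarrow>
      \<exists>t. permitted n t \<and> accomplishes unconstrained_spies \<Omega> correct t u"
  shows "\<exists>t. permitted n t \<and> accomplishes unconstrained_spies \<Omega> correct t
           (card R - binary_ones (\<Sum>r\<in>R. 2 ^ e r) + u)"
  using assms
proof (induction "card R" arbitrary: R e \<Omega> rule: less_induct)
  case less
  let ?b = "binary_ones (\<Sum>r\<in>R. 2 ^ e r)"
  show ?case
  proof (cases "inj_on e R")
    case True
    then obtain t where "permitted n t" "accomplishes unconstrained_spies \<Omega> correct t u"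
      using less.prems(4)[of R e \<Omega>] less.prems(3) by blast
    then show ?thesis using accomplishes_mono[OF _ order_refl] by (meson le_add2)
  next
    case False
    then obtain x y where xy: "x \<in> R" "y \<in> R" "x \<noteq> y" "e x = e y"
      by (auto simp: inj_on_def)
    note fin = \<open>finite R\<close>
    let ?e = "e(y := Suc (e y))"
    have card1: "card (R - {x}) = card R - 1" "card R \<ge> 2"
      using xy fin card_mono[of R "{x, y}"] by auto
    have card2: "card (R - {x, y}) = card R - 2"
      using xy fin by (simp add: card_Diff_subset)
    let ?yes = "{A \<in> \<Omega>. unconstrained_spies A x y True}"
    let ?no = "{A \<in> \<Omega>. unconstrained_spies A x y False}"
    have IH: "\<exists>t. permitted n t \<and> accomplishes unconstrained_spies \<Omega>' correct t
        (card R' - binary_ones (\<Sum>r\<in>R'. 2 ^ e' r) + u)"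
      if "card R' < card R" "R' \<subseteq> R" "\<And>A. A \<in> \<Omega>' \<Longrightarrow> \<theta> A \<le> surplus e' R' A" for R' e' \<Omega>'
    proof (rule less.hyps[OF that(1)])
      show "finite R'" using that(2) fin by (rule finite_subset)
      show "R' \<subseteq> {1..n}" using that(2) less.prems(2) by (rule subset_trans)
      show "\<theta> A \<le> surplus e' R' A" if "A \<in> \<Omega>'" for A using that by fact
      show "\<exists>t. permitted n t \<and> accomplishes unconstrained_spies \<Omega>'' correct t u"
        if "R'' \<subseteq> R'" "inj_on e'' R''" "\<And>A. A \<in> \<Omega>'' \<Longrightarrow> \<theta> A \<le> surplus e'' R'' A" for e'' R'' \<Omega>''
        by (rule less.prems(4)[OF subset_trans[OF that(1) \<open>R' \<subseteq> R\<close>] that(2,3)])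
    qed
    have "\<exists>t. permitted n t \<and> accomplishes unconstrained_spies ?yes correct t
        (card (R - {x, y}) - binary_ones (\<Sum>r\<in>R - {x, y}. 2 ^ e r) + u)"
    proof (rule IH)
      show "\<theta> A \<le> surplus e (R - {x, y}) A" if "A \<in> ?yes" for A
        using that less.prems(3)[of A] surplus_discard[OF fin xy, of A]
        by (auto simp: unconstrained_spies_def)
    qed (use card1 card2 in auto)
    then obtain s where s: "permitted n s" "accomplishes unconstrained_spies ?yes correct s
        (card (R - {x, y}) - binary_ones (\<Sum>r\<in>R - {x, y}. 2 ^ e r) + u)"
      by blast
    have "\<exists>t. permitted n t \<and> accomplishes unconstrained_spies ?no correct t
        (card (R - {x}) - binary_ones (\<Sum>r\<in>R - {x}. 2 ^ ?e r) + u)"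
    proof (rule IH)
      show "\<theta> A \<le> surplus ?e (R - {x}) A" if "A \<in> ?no" for A
        using that less.prems(3)[of A] surplus_merge[OF fin xy, of A]
        by (auto simp: unconstrained_spies_def)
    qed (use card1 in auto)
    then obtain t where t: "permitted n t" "accomplishes unconstrained_spies ?no correct t
        (card (R - {x}) - ?b + u)"
      unfolding total_weight_merge[OF fin xy] by blast
    \<comment> \<open>Discarding removes two roots but at most one binary one; merging removes one
      root and keeps the total weight. Either way the bound drops enough to pay for the
      question.\<close>
    have "?b \<le> Suc (binary_ones (\<Sum>r\<in>R - {x, y}. 2 ^ e r))"
      unfolding total_weight_discard[OF fin xy] by (rule binary_ones_add_power_le)
    moreover have "binary_ones (\<Sum>r\<in>R - {x, y}. 2 ^ e r) \<le> card (R - {x, y})"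
      using fin by (intro binary_ones_sum_powers_le) auto
    moreover have "?b \<le> card (R - {x})"
      using fin binary_ones_sum_powers_le[of "R - {x}" ?e]
      unfolding total_weight_merge[OF fin xy] by auto
    ultimately have
      "card (R - {x, y}) - binary_ones (\<Sum>r\<in>R - {x, y}. 2 ^ e r) + u \<le> card R - ?b - 1 + u"
      "card (R - {x}) - ?b + u \<le> card R - ?b - 1 + u"
      and Suc: "card R - ?b + u = Suc (card R - ?b - 1 + u)"
      using card1 card2 by linarith+
    then have "accomplishes unconstrained_spies \<Omega> correct (Ask x y s t) (card R - ?b + u)"
      unfolding Suc accomplishes_Ask using s t accomplishes_mono[OF _ order_refl] by blast
    moreover have "permitted n (Ask x y s t)" using s t xy less.prems(2) by auto
    ultimately show ?thesis by blast
  qed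
qed

lemma surplus_unit:
  assumes "finite R"
  shows "surplus (\<lambda>_. 0) R A = 2 * int (card (R \<inter> A)) - int (card R)"
proof -
  have "surplus (\<lambda>_. 0) R A = int (card (R \<inter> A)) - int (card (R - A))"
    using assms by (simp add: surplus_def sum.If_cases Diff_eq)
  moreover have "card R = card (R \<inter> A) + card (R - A)"
    using assms by (metis Int_Diff_Un Int_Diff_disjoint card_Un_disjoint finite_Diff finite_Int)
  ultimately show ?thesis by simp
qed

lemma card_Int_lower:
  assumes "A \<subseteq> {1..n::nat}" "R \<subseteq> {1..n}" "k \<le> card A"
  shows "card R + k \<le> card (R \<inter> A) + n"
proof -
  have "card (R \<union> A) \<le> n" using assms card_mono[of "{1..n}" "R \<union> A"] by auto
  then show ?thesis
    using assms card_Un_Int[of R A] finite_subset[of _ "{1..n}"] by fastforce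
qed

section \<open>Upper bounds for finding a knight\<close>

text \<open>Among any \<open>2 * (n - k) + 1\<close> people the knights are a majority, so the
  surplus starts at 1 or more. The map \<open>f\<close> turns a certain knight into an announcement,
  which lets one argument serve both \<open>is_knight\<close> and
  \<open>is_identity\<close>.\<close>

lemma knight_strategy:
  assumes "n < 2 * k" "k < n"
    and f: "\<And>A x. x \<in> {1..n} \<Longrightarrow> x \<in> A \<Longrightarrow> correct A (f x)"
  shows "\<exists>t. permitted n t \<and> accomplishes unconstrained_spies (situations n k) correct t
           (2 * (n - k) - binary_ones (n - k))"
proof -
  define s where "s = n - k"
  let ?R = "{1..Suc (2 * s)}"
  have R: "?R \<subseteq> {1..n}" using assms by (auto simp: s_def)
  have "\<exists>t. permitted n t \<and> accomplishes unconstrained_spies (situations n k) correct t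
           (card ?R - binary_ones (\<Sum>r\<in>?R. 2 ^ (\<lambda>_. 0) r) + 0)"
  proof (rule merging_strategy[where \<theta> = "\<lambda>_. 1"])
    show "1 \<le> surplus (\<lambda>_. 0) ?R A" if "A \<in> situations n k" for A
      using that card_Int_lower[of A n ?R k] R assms
      by (auto simp: surplus_unit situations_def s_def)
    show "\<exists>t. permitted n t \<and> accomplishes unconstrained_spies \<Omega> correct t 0"
      if R': "R' \<subseteq> ?R" and inj: "inj_on e R'"
        and \<Omega>: "\<And>A. A \<in> \<Omega> \<Longrightarrow> 1 \<le> surplus e R' A" for e R' \<Omega>
    proof (cases "R' = {}")
      \<comment> \<open>The surplus of no roots is 0, so no situation is left and any announcement
        will do.\<close>
      case True
      then have "\<Omega> = {}" using \<Omega> by (auto simp: surplus_def)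
      then show ?thesis by (intro exI[of _ "Announce undefined"]) auto
    next
      case False
      have "finite R'" using R' finite_subset by blast
      then obtain x where "x \<in> R'" "\<And>A. 0 \<le> surplus e R' A \<Longrightarrow> x \<in> A"
        using heaviest_root_is_knight[OF _ inj False] by blast
      then have "correct A (f x)" if "A \<in> \<Omega>" for A
        using \<Omega>[OF that] that R' R by (intro f) force+
      then show ?thesis by (intro exI[of _ "Announce (f x)"]) auto
    qed
  qed (use R in auto)
  \<comment> \<open>\<open>2 * s + 1\<close> has one binary one more than \<open>s\<close>, which
    offsets the extra root.\<close>
  then show ?thesis by (simp add: s_def)
qed

section \<open>Upper bounds for Person 1\<close>

text \<open>The share of Person 1 in the surplus, as a group of weight 1 that is kept out of the
  merging.\<close>

definition bias :: "nat set \<Rightarrow> int" where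
  "bias A = (if 1 \<in> A then 1 else -1)"

text \<open>With Person 1 set aside, the surplus of the roots is at least \<open>1 - bias A\<close>,
  hence nonnegative, and still reveals a knight. The extra question asks this knight about Person
  1.\<close>

lemma bias_strategy:
  assumes "finite R" "R \<subseteq> {1..n}" "1 \<notin> R" "0 < n"
    and "\<And>A. A \<in> \<Omega> \<Longrightarrow> 0 < surplus e R A + bias A"
  shows "\<exists>t. permitted n t \<and> accomplishes unconstrained_spies \<Omega> (is_identity_of 1) t
           (card R - binary_ones (\<Sum>r\<in>R. 2 ^ e r) + 1)"
proof (rule merging_strategy[where \<theta> = "\<lambda>A. 1 - bias A"])
  show "1 - bias A \<le> surplus e R A" if "A \<in> \<Omega>" for A
    using assms(5)[OF that] by simp
  show "\<exists>t. permitted n t \<and> accomplishes unconstrained_spies \<Omega> (is_identity_of 1) t 1"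
    if R': "R' \<subseteq> R" and inj: "inj_on e R'"
      and \<Omega>: "\<And>A. A \<in> \<Omega> \<Longrightarrow> 1 - bias A \<le> surplus e R' A" for e R' \<Omega>
  proof (cases "R' = {}")
    \<comment> \<open>With no roots left, only the bias can make the sum positive.\<close>
    case True
    then have "1 \<in> A" if "A \<in> \<Omega>" for A
      using \<Omega>[OF that] by (auto simp: surplus_def bias_def split: if_splits)
    then show ?thesis by (intro exI[of _ "Announce True"]) (auto simp: is_identity_of_def)
  next
    case False
    have "finite R'" using R' assms finite_subset by blast
    then obtain x where x: "x \<in> R'" "\<And>A. 0 \<le> surplus e R' A \<Longrightarrow> x \<in> A"
      using heaviest_root_is_knight[OF _ inj False] by blast
    have "x \<in> A" if "A \<in> \<Omega>" for A
      using \<Omega>[OF that] by (intro x) (auto simp: bias_def split: if_splits)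
    then have "accomplishes unconstrained_spies \<Omega> (is_identity_of 1)
        (Ask x 1 (Announce False) (Announce True)) (Suc 0)"
      by (auto simp: unconstrained_spies_def is_identity_of_def)
    moreover have "permitted n (Ask x 1 (Announce False) (Announce True))"
      using x R' assms by auto
    ultimately show ?thesis unfolding One_nat_def by blast
  qed
qed (use assms in auto)

lemma surplus_plus_bias_pos:
  assumes "n < 2 * k" "k < n" "A \<in> situations n k"
  shows "0 < surplus (\<lambda>_. 0) {2..Suc (2 * (n - k))} A + bias A"
proof -
  let ?R = "{1..Suc (2 * (n - k))}"
  have *: "{Suc 0..Suc (2 * (n - k))} - {Suc 0} = {2..Suc (2 * (n - k))}" by auto
  have "?R \<subseteq> {1..n}" using assms by auto
  then have "0 < surplus (\<lambda>_. 0) ?R A"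
    using assms card_Int_lower[of A n ?R k] by (auto simp: surplus_unit situations_def)
  also have "\<dots> = surplus (\<lambda>_. 0) {2..Suc (2 * (n - k))} A + bias A"
    by (subst surplus_remove[of _ 1]) (auto simp: bias_def *)
  finally show ?thesis .
qed

lemma nominee_strategy:
  assumes "n < 2 * k" "k < n"
  shows "\<exists>t. permitted n t \<and> accomplishes unconstrained_spies (situations n k) (is_identity_of 1) t
           (2 * (n - k) - binary_ones (n - k) + 1)"
proof -
  let ?R = "{2..Suc (2 * (n - k))}"
  have "\<exists>t. permitted n t \<and> accomplishes unconstrained_spies (situations n k) (is_identity_of 1) t
           (card ?R - binary_ones (\<Sum>r\<in>?R. 2 ^ (\<lambda>_. 0) r) + 1)"
    using assms surplus_plus_bias_pos[OF assms] by (intro bias_strategy) auto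
  then show ?thesis by simp
qed

text \<open>
  The saving of one question: either the whole of \<open>R\<close> is merged, so that everybody in it is a
  knight and 1 is the spy, or some pair of equal groups cancels, and then any remaining weight
  has at least as many binary ones as the original power of two.
\<close>

lemma power_of_two_strategy:
  assumes "finite R" "R \<subseteq> {1..n}" "1 \<notin> R" "0 < n" "0 < E"
    and "(\<Sum>r\<in>R. 2 ^ e r) = (2 ^ E :: nat)"
    and "\<And>A. A \<in> \<Omega> \<Longrightarrow> 0 < surplus e R A + bias A"
    and "\<And>A. A \<in> \<Omega> \<Longrightarrow> R \<subseteq> A \<Longrightarrow> 1 \<notin> A"
  shows "\<exists>t. permitted n t \<and> accomplishes lying_spies \<Omega> (is_identity_of 1) t (card R - 1)"
  using assms
proof (induction "card R" arbitrary: R e \<Omega> rule: less_induct)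
  case less
  note fin = \<open>finite R\<close> and pos = less.prems(7) and spy = less.prems(8)
  have "R \<noteq> {}" using less.prems(6) by auto
  then obtain x where x: "x \<in> R" by blast
  show ?case
  proof (cases "R = {x}")
    case True
    \<comment> \<open>The lone root outweighs the bias because \<open>0 < E\<close>, so it is a
      knight.\<close>
    then have "e x = E" using less.prems(6) by simp
    then have "(2::int) \<le> 2 ^ e x"
      using less.prems(5) power_increasing[of 1 E "2 :: int"] by simp
    then have "x \<in> A" if "A \<in> \<Omega>" for A
      using pos[OF that] by (auto simp: True surplus_def bias_def split: if_splits)
    then have "1 \<notin> A" if "A \<in> \<Omega>" for A
      using spy[OF that] that True by blast
    then show ?thesis by (intro exI[of _ "Announce False"]) (auto simp: is_identity_of_def)
  next
    case False
    \<comment> \<open>Distinct powers of two below \<open>2 ^ E\<close> cannot add up to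
      \<open>2 ^ E\<close>, so two roots of equal weight remain.\<close>
    have "\<not> inj_on e R"
    proof
      assume inj: "inj_on e R"
      have "e r < E" if "r \<in> R" for r
      proof -
        have "R - {r} \<noteq> {}" using False x that by blast
        then have "0 < (\<Sum>r\<in>R - {r}. 2 ^ e r :: nat)" using fin by (intro sum_pos) auto
        then have "2 ^ e r < (2 :: nat) ^ E"
          using less.prems(6) sum.remove[OF fin that, of "\<lambda>r. 2 ^ e r :: nat"] by linarith
        then show ?thesis by simp
      qed
      then have "(\<Sum>r\<in>R. (2::int) ^ e r) < 2 ^ E"
        by (intro sum_distinct_powers_less fin inj)
      also have "\<dots> = int (\<Sum>r\<in>R. 2 ^ e r)" unfolding less.prems(6) by simp
      finally show False by simp
    qed
    then obtain x y where xy: "x \<in> R" "y \<in> R" "x \<noteq> y" "e x = e y"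
      by (auto simp: inj_on_def)
    let ?e = "e(y := Suc (e y))" and ?R = "R - {x, y}"
    have card1: "card (R - {x}) = card R - 1" "card R \<ge> 2"
      using xy fin card_mono[of R "{x, y}"] by auto
    have card2: "card ?R = card R - 2"
      using xy fin by (simp add: card_Diff_subset)
    let ?yes = "{A \<in> \<Omega>. lying_spies A x y True}" and ?no = "{A \<in> \<Omega>. lying_spies A x y False}"
    have "\<exists>t. permitted n t \<and> accomplishes lying_spies ?no (is_identity_of 1) t (card (R - {x}) - 1)"
    proof (rule less.hyps)
      show "card (R - {x}) < card R" using card1 by simp
      show "(\<Sum>r\<in>R - {x}. 2 ^ ?e r) = (2 ^ E :: nat)"
        unfolding total_weight_merge[OF fin xy] by fact
      show "0 < surplus ?e (R - {x}) A + bias A" if "A \<in> ?no" for A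
        using that pos[of A] surplus_merge[OF fin xy, of A]
        by (auto simp: lying_spies_def split: if_splits)
      show "1 \<notin> A" if "A \<in> ?no" "R - {x} \<subseteq> A" for A
      proof -
        \<comment> \<open>When spies lie, "no" means that \<open>x\<close> and \<open>y\<close> are
          of the same kind, so \<open>x\<close> is a knight together with \<open>y\<close>.\<close>
        have "x \<in> A" using that xy by (auto simp: lying_spies_def split: if_splits)
        then show ?thesis using that spy[of A] by blast
      qed
    qed (use less.prems in auto)
    then obtain t where t: "permitted n t"
      "accomplishes lying_spies ?no (is_identity_of 1) t (card (R - {x}) - 1)" by blast
    have pos2: "0 < surplus e ?R A + bias A" if "A \<in> ?yes" for A
      using that pos[of A] surplus_discard[OF fin xy, of A]
      by (auto simp: lying_spies_def split: if_splits)
    have "\<exists>s. permitted n s \<and> accomplishes lying_spies ?yes (is_identity_of 1) s (card ?R)"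
    proof (cases "?R = {}")
      case True
      have "1 \<in> A" if "A \<in> ?yes" for A
        using pos2[OF that] unfolding True by (auto simp: surplus_def bias_def split: if_splits)
      then show ?thesis by (intro exI[of _ "Announce True"]) (auto simp: is_identity_of_def)
    next
      case False
      obtain s where s: "permitted n s" "accomplishes unconstrained_spies ?yes (is_identity_of 1) s
          (card ?R - binary_ones (\<Sum>r\<in>?R. 2 ^ e r) + 1)"
        using bias_strategy[of ?R n ?yes e] pos2 less.prems(2-4) fin by blast
      \<comment> \<open>Any positive weight has a binary one, and this pays for the final question
        about Person 1.\<close>
      have "0 < binary_ones (\<Sum>r\<in>?R. 2 ^ e r)"
        using False fin by (intro binary_ones_pos sum_pos) auto
      moreover have "binary_ones (\<Sum>r\<in>?R. 2 ^ e r) \<le> card ?R"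
        using fin by (intro binary_ones_sum_powers_le) auto
      ultimately have "card ?R - binary_ones (\<Sum>r\<in>?R. 2 ^ e r) + 1 \<le> card ?R" by linarith
      then show ?thesis
        using s accomplishes_mono[OF _ order_refl] accomplishes_unconstrained_imp_lying by blast
    qed
    then obtain s where s: "permitted n s" "accomplishes lying_spies ?yes (is_identity_of 1) s (card ?R)"
      by blast
    have Suc: "card R - 1 = Suc (card ?R)" "card (R - {x}) - 1 = card ?R"
      using card1 card2 by linarith+
    have "accomplishes lying_spies \<Omega> (is_identity_of 1) (Ask x y s t) (card R - 1)"
      unfolding Suc(1) accomplishes_Ask using s t Suc(2) by simp
    moreover have "permitted n (Ask x y s t)" using s t xy less.prems(2) by auto
    ultimately show ?thesis by blast
  qed
qed

text \<open>Everybody except Person 1 is a root, and the total weight \<open>2 * (n - k)\<close> is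
  a power of two. As some spy is present, Person 1 is a spy if all roots are knights.\<close>

lemma exceptional_strategy:
  assumes "n = 2 ^ (e + 1) + 1" "k = 2 ^ e + 1"
  shows "\<exists>t. permitted n t \<and> accomplishes lying_spies (situations_with_spy n k) (is_identity_of 1) t
           (2 * (n - k) - binary_ones (n - k))"
proof -
  let ?R = "{2..n}"
  have nk: "n - k = 2 ^ e" "n < 2 * k" "k < n" using assms by auto
  have n: "n = Suc (2 * (n - k))" using assms by simp
  have "\<exists>t. permitted n t \<and> accomplishes lying_spies (situations_with_spy n k) (is_identity_of 1) t
           (card ?R - 1)"
  proof (rule power_of_two_strategy)
    show "(\<Sum>r\<in>?R. 2 ^ (\<lambda>_. 0) r) = (2 ^ (e + 1) :: nat)" using assms by simp
    show "0 < surplus (\<lambda>_. 0) ?R A + bias A" if "A \<in> situations_with_spy n k" for A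
      using surplus_plus_bias_pos[OF nk(2,3), of A] that n by (simp add: situations_with_spy_def)
    show "1 \<notin> A" if "A \<in> situations_with_spy n k" "?R \<subseteq> A" for A
    proof
      assume "1 \<in> A"
      moreover have "{1..n} \<subseteq> insert 1 ?R" by auto
      ultimately show False using that by (auto simp: situations_with_spy_def)
    qed
  qed (use assms in auto)
  then show ?thesis using assms by (simp add: nk(1))
qed

section \<open>Weights of positions\<close>

definition geometric_fps :: "int fps" where
  "geometric_fps = Abs_fps (\<lambda>_. 1)"

lemma one_minus_X_mult_geometric_fps: "(1 - fps_X) * geometric_fps = 1"
proof (rule fps_ext)
  fix i show "fps_nth ((1 - fps_X) * geometric_fps) i = fps_nth 1 i"
    by (cases i) (auto simp: geometric_fps_def ring_distribs)
qed

lemma power_mult_geometric_fps_power: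
  "(1 - fps_X) ^ i * geometric_fps ^ j =
     (if i < j then geometric_fps ^ (j - i) else (1 - fps_X) ^ (i - j))"
proof -
  have *: "(1 - fps_X) ^ m * geometric_fps ^ m = 1" for m
    by (simp add: one_minus_X_mult_geometric_fps flip: power_mult_distrib)
  show ?thesis
  proof (cases "i < j")
    case True
    then have "geometric_fps ^ j = geometric_fps ^ i * geometric_fps ^ (j - i)"
      by (simp flip: power_add)
    then show ?thesis using True *[of i] by (simp flip: mult.assoc)
  next
    case False
    then obtain l where l: "i = j + l" by (metis le_Suc_ex not_less)
    have "(1 - fps_X) ^ i * geometric_fps ^ j = (1 - fps_X) ^ l * ((1 - fps_X) ^ j * geometric_fps ^ j)"
      unfolding l power_add by (simp only: mult_ac)
    then show ?thesis unfolding * using l by simp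
  qed
qed

lemma fps_nth_one_minus_X_power: "fps_nth ((1 - fps_X :: int fps) ^ m) j = (-1) ^ j * int (m choose j)"
proof (induction m arbitrary: j)
  case 0
  show ?case by (cases j) auto
next
  case (Suc m)
  have "(1 - fps_X :: int fps) ^ Suc m = (1 - fps_X) ^ m - fps_X * (1 - fps_X) ^ m"
    by (simp add: ring_distribs)
  then show ?case using Suc by (cases j) (auto simp: ring_distribs)
qed

text \<open>Substitutes \<open>1 - X\<close> for the variable \<open>z\<close>. A power
  \<open>(z - 1) ^ j\<close>, which will stand for \<open>j\<close> spies, becomes
  \<open>(- X) ^ j\<close>, while the ordinary coefficients of \<open>P\<close> become coefficients
  of powers of \<open>1 - X\<close>, which cancel against the denominator of the weights.\<close>

definition expand_at_1 :: "int poly \<Rightarrow> int fps" where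
  "expand_at_1 P = fps_of_poly (pcompose P [:1, -1:])"

lemma expand_at_1_power: "expand_at_1 ([:-1, 1:] ^ m) = (- fps_X) ^ m"
proof -
  have "fps_of_poly [:0, -1 :: int:] = - fps_X"
    using fps_of_poly_uminus[of "[:0, 1 :: int:]"] by simp
  moreover have "pcompose ([:-1, 1 :: int:] ^ m) q = (pcompose [:-1, 1:] q) ^ m" for q
    by (induction m) (simp_all only: power_0 power_Suc pcompose_1 pcompose_mult)
  ultimately show ?thesis
    by (simp add: expand_at_1_def pcompose_pCons fps_of_poly_power)
qed

lemma expand_at_1_sum: "expand_at_1 (sum f S) = (\<Sum>x\<in>S. expand_at_1 (f x))"
  by (simp add: expand_at_1_def pcompose_sum fps_of_poly_sum)

lemma expand_at_1_altdef:
  "expand_at_1 P = (\<Sum>j\<le>degree P. fps_const (coeff P j) * (1 - fps_X) ^ j)"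
proof -
  have "fps_of_poly [:1, -1 :: int:] = 1 - fps_X"
    using fps_of_poly_diff[of "[:1 :: int:]" "[:0, 1:]"] by simp
  moreover have "pcompose (monom a i) q = smult a (q ^ i)" for a i and q :: "int poly"
    by (induction i) (simp_all add: monom_0 monom_Suc pcompose_pCons)
  ultimately have *: "expand_at_1 (monom a i) = fps_const a * (1 - fps_X) ^ i" for a i
    by (simp add: expand_at_1_def fps_of_poly_smult fps_of_poly_power)
  have "expand_at_1 P = expand_at_1 (\<Sum>i\<le>degree P. monom (coeff P i) i)"
    by (simp add: poly_as_sum_of_monoms)
  then show ?thesis by (simp only: expand_at_1_sum *)
qed

text \<open>Membership in the \<open>m\<close>-th power of the ideal generated by \<open>2\<close> and the variable.\<close>

definition filtered :: "nat \<Rightarrow> int poly \<Rightarrow> bool" where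
  "filtered m P \<longleftrightarrow> (\<forall>j. 2 ^ (m - j) dvd coeff P j)"

lemma filtered_0: "filtered 0 P"
  by (simp add: filtered_def)

lemma filtered_mult: "filtered m P \<Longrightarrow> filtered m (P * Q)"
  unfolding filtered_def coeff_mult
  by (intro allI dvd_sum dvd_mult2) (auto intro: power_le_dvd)

text \<open>An even constant coefficient puts \<open>Q\<close> into the ideal, so the product lies
  one power deeper: in each term either \<open>P\<close> supplies an earlier, more divisible
  coefficient or \<open>Q\<close> supplies the factor 2.\<close>

lemma filtered_mult_even:
  assumes "filtered m P" "even (coeff Q 0)"
  shows "filtered (Suc m) (P * Q)"
  unfolding filtered_def coeff_mult
proof (intro allI dvd_sum)
  fix j i :: nat assume i: "i \<in> {..j}"
  have P: "2 ^ (m - i) dvd coeff P i" using assms by (simp add: filtered_def)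
  show "2 ^ (Suc m - j) dvd coeff P i * coeff Q (j - i)"
  proof (cases "i = j")
    case True
    then have "2 ^ Suc (m - j) dvd coeff P i * coeff Q (j - i)"
      using mult_dvd_mono[OF P, of 2 "coeff Q 0"] assms by (simp add: mult.commute)
    then show ?thesis by (rule power_le_dvd) simp
  next
    case False
    then have "Suc m - j \<le> m - i" using i by auto
    then show ?thesis using P by (meson dvd_mult2 power_le_dvd)
  qed
qed

lemma filtered_prod:
  assumes "finite I" "\<And>i. i \<in> I \<Longrightarrow> even (coeff (Q i) 0)"
  shows "filtered (card I) (\<Prod>i\<in>I. Q i)"
  using assms
proof (induction I rule: finite_induct)
  case empty
  show ?case by (simp add: filtered_0)
next
  case (insert i I)
  then have "filtered (Suc (card I)) (prod Q I * Q i)"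
    by (intro filtered_mult_even) auto
  then show ?case using insert by (simp add: mult.commute)
qed

text \<open>
  The terms of degree at least \<open>\<delta>\<close> in the expansion at 1 contribute a polynomial
  of degree less than \<open>N\<close> to the quotient by \<open>(1 - X) ^ \<delta>\<close>.
\<close>

lemma filtered_imp_coeff_dvd:
  assumes "filtered m P" "degree P < N + \<delta>"
  shows "2 ^ (Suc m - \<delta>) dvd fps_nth (expand_at_1 P * geometric_fps ^ \<delta>) N"
proof -
  have "expand_at_1 P * geometric_fps ^ \<delta> =
      (\<Sum>j\<le>degree P. fps_const (coeff P j) * ((1 - fps_X) ^ j * geometric_fps ^ \<delta>))"
    by (simp add: expand_at_1_altdef sum_distrib_right mult.assoc)
  then have eq: "fps_nth (expand_at_1 P * geometric_fps ^ \<delta>) N =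
      (\<Sum>j\<le>degree P. coeff P j * fps_nth ((1 - fps_X) ^ j * geometric_fps ^ \<delta>) N)"
    by (simp add: fps_sum_nth)
  show ?thesis
    unfolding eq
  proof (rule dvd_sum)
    fix j assume j: "j \<in> {..degree P}"
    show "2 ^ (Suc m - \<delta>) dvd coeff P j * fps_nth ((1 - fps_X) ^ j * geometric_fps ^ \<delta>) N"
    proof (cases "j < \<delta>")
      case True
      then have "2 ^ (Suc m - \<delta>) dvd coeff P j"
        using assms(1) power_le_dvd[of 2 "m - j" "coeff P j" "Suc m - \<delta>"] by (simp add: filtered_def)
      then show ?thesis by simp
    next
      case False
      then have "j - \<delta> < N" using j assms(2) by auto
      then show ?thesis
        using False by (simp add: power_mult_geometric_fps_power fps_nth_one_minus_X_power binomial_eq_0)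
    qed
  qed
qed

section \<open>Positions as components with two sides\<close>

text \<open>
  When spies always lie, an answer reveals exactly whether the two people are of the same kind. So
  a position consists of components \<open>c\<close> and, within each component, two sides \<open>d\<close>.
\<close>

definition compat :: "nat \<Rightarrow> (nat \<Rightarrow> nat) \<Rightarrow> (nat \<Rightarrow> bool) \<Rightarrow> nat set set" where
  "compat n c d = {A. A \<subseteq> {1..n} \<and>
     (\<forall>x\<in>{1..n}. \<forall>y\<in>{1..n}. c x = c y \<longrightarrow> ((x \<in> A) = (y \<in> A)) = (d x = d y))}"

definition comps :: "nat \<Rightarrow> (nat \<Rightarrow> nat) \<Rightarrow> nat" where
  "comps n c = card (c ` {1..n})"

lemma finite_compat: "finite (compat n c d)"
  by (rule finite_subset[of _ "Pow {1..n}"]) (auto simp: compat_def)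

lemma compat_subset: "A \<in> compat n c d \<Longrightarrow> A \<subseteq> {1..n}"
  by (simp add: compat_def)

lemma compat_iff: "A \<in> compat n c d \<Longrightarrow> x \<in> {1..n} \<Longrightarrow> y \<in> {1..n} \<Longrightarrow> c x = c y \<Longrightarrow>
    ((x \<in> A) = (y \<in> A)) = (d x = d y)"
  unfolding compat_def by blast

lemma compat_complement: "A \<in> compat n c d \<Longrightarrow> {1..n} - A \<in> compat n c d"
  unfolding compat_def by auto

lemma compat_flip_component:
  assumes "A \<in> compat n c d"
  shows "{x \<in> {1..n}. (x \<in> A) \<noteq> (c x = i)} \<in> compat n c d"
  using assms unfolding compat_def by auto

lemma compat_discrete: "inj c \<Longrightarrow> compat n c d = Pow {1..n}"
  unfolding compat_def by (auto dest: injD)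

text \<open>An answer about people in different components joins these. The component of
  \<open>y\<close> takes over the label of that of \<open>x\<close>, with its sides swapped if they
  would otherwise contradict the answer.\<close>

lemma compat_refine:
  assumes "x \<in> {1..n}" "y \<in> {1..n}" "c x \<noteq> c y"
  obtains c' d' where "compat n c' d' = {A \<in> compat n c d. ((x \<in> A) = (y \<in> A)) = b}"
    "Suc (comps n c') = comps n c"
proof
  define f where "f \<longleftrightarrow> (d x = d y) \<noteq> b"
  let ?c = "\<lambda>z. if c z = c y then c x else c z" and ?d = "\<lambda>z. if c z = c y then d z \<noteq> f else d z"
  show "compat n ?c ?d = {A \<in> compat n c d. ((x \<in> A) = (y \<in> A)) = b}"
  proof (intro equalityI subsetI)
    fix A assume A: "A \<in> compat n ?c ?d"
    have "((u \<in> A) = (v \<in> A)) = (d u = d v)" if "u \<in> {1..n}" "v \<in> {1..n}" "c u = c v" for u v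
      using compat_iff[OF A that(1,2)] that(3) by (auto split: if_splits)
    moreover have "((x \<in> A) = (y \<in> A)) = b"
      using compat_iff[OF A assms(1,2)] assms(3) by (auto simp: f_def split: if_splits)
    ultimately show "A \<in> {A \<in> compat n c d. ((x \<in> A) = (y \<in> A)) = b}"
      using compat_subset[OF A] by (simp add: compat_def)
  next
    fix A assume "A \<in> {A \<in> compat n c d. ((x \<in> A) = (y \<in> A)) = b}"
    then have A: "A \<in> compat n c d" and b: "((x \<in> A) = (y \<in> A)) = b" by auto
    have "((u \<in> A) = (v \<in> A)) = (?d u = ?d v)" if uv: "u \<in> {1..n}" "v \<in> {1..n}" "?c u = ?c v" for u v
    proof -
      consider "c u = c v" | "c u = c y" "c v = c x" | "c u = c x" "c v = c y"
        using uv(3) by (auto split: if_splits)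
      then show ?thesis
      proof cases
        case 1
        then show ?thesis using compat_iff[OF A uv(1,2)] by auto
      next
        case 2
        then show ?thesis
          using compat_iff[OF A uv(1) assms(2)] compat_iff[OF A uv(2) assms(1)] b assms(3)
          by (auto simp: f_def)
      next
        case 3
        then show ?thesis
          using compat_iff[OF A uv(1) assms(1)] compat_iff[OF A uv(2) assms(2)] b assms(3)
          by (auto simp: f_def)
      qed
    qed
    then show "A \<in> compat n ?c ?d" using compat_subset[OF A] by (simp add: compat_def)
  qed
  have "?c ` {1..n} = c ` {1..n} - {c y}"
    using assms by (auto simp: image_iff)
  moreover have "c y \<in> c ` {1..n}" using assms by blast
  ultimately show "Suc (comps n ?c) = comps n c"
    unfolding comps_def by (metis card_Suc_Diff1 finite_atLeastAtMost finite_imageI)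
qed

text \<open>The component of \<open>x0\<close> is settled, and every other one chooses independently
  which of its sides are knights; so the generating function of the number of spies factors.\<close>

lemma sum_compat_prod:
  fixes z :: "'a :: comm_ring_1"
  assumes x0: "x0 \<in> {1..n}"
  shows "(\<Sum>A | A \<in> compat n c d \<and> x0 \<in> A. z ^ (n - card A)) =
    z ^ card {x \<in> {1..n}. c x = c x0 \<and> d x \<noteq> d x0} *
    (\<Prod>i\<in>c ` {1..n} - {c x0}.
       z ^ card {x \<in> {1..n}. c x = i \<and> \<not> d x} + z ^ card {x \<in> {1..n}. c x = i \<and> d x})"
proof -
  let ?I = "c ` {1..n} - {c x0}"
  define a b p where "a i = card {x \<in> {1..n}. c x = i \<and> \<not> d x}"
    and "b i = card {x \<in> {1..n}. c x = i \<and> d x}"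
    and "p = card {x \<in> {1..n}. c x = c x0 \<and> d x \<noteq> d x0}" for i
  \<comment> \<open>\<open>T\<close> collects the components in which the side marked
    \<open>True\<close> consists of knights; \<open>F\<close> and \<open>G\<close> translate between
    such choices and sets of knights.\<close>
  define F where "F T = {x \<in> {1..n}. d x = (if c x = c x0 then d x0 else c x \<in> T)}" for T
  define G where "G A = {i \<in> ?I. \<exists>x\<in>{1..n}. c x = i \<and> (x \<in> A) = d x}" for A
  have spies: "n - card (F T) = p + (\<Sum>i\<in>?I. if i \<in> T then a i else b i)" if "T \<subseteq> ?I" for T
  proof -
    have "n - card (F T) = card ({1..n} - F T)"
      by (subst card_Diff_subset) (auto simp: F_def)
    also have "{1..n} - F T = (\<Union>i\<in>c ` {1..n}. {x \<in> {1..n}. c x = i \<and> x \<notin> F T})"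
      by auto
    also have "card \<dots> = (\<Sum>i\<in>c ` {1..n}. card {x \<in> {1..n}. c x = i \<and> x \<notin> F T})"
      by (rule card_UN_disjoint) auto
    also have "\<dots> = card {x \<in> {1..n}. c x = c x0 \<and> x \<notin> F T}
        + (\<Sum>i\<in>?I. card {x \<in> {1..n}. c x = i \<and> x \<notin> F T})"
      using x0 by (intro sum.remove) auto
    also have "{x \<in> {1..n}. c x = c x0 \<and> x \<notin> F T} = {x \<in> {1..n}. c x = c x0 \<and> d x \<noteq> d x0}"
      by (auto simp: F_def)
    also have "(\<Sum>i\<in>?I. card {x \<in> {1..n}. c x = i \<and> x \<notin> F T}) = (\<Sum>i\<in>?I. if i \<in> T then a i else b i)"
      by (intro sum.cong refl) (auto simp: a_def b_def F_def intro!: arg_cong[of _ _ card])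
    finally show ?thesis by (simp add: p_def)
  qed
  have "(\<Sum>A | A \<in> compat n c d \<and> x0 \<in> A. z ^ (n - card A)) = (\<Sum>T\<in>Pow ?I. z ^ (n - card (F T)))"
  proof (rule sum.reindex_bij_witness[where i = F and j = G])
    fix A assume "A \<in> {A. A \<in> compat n c d \<and> x0 \<in> A}"
    then have A: "A \<in> compat n c d" "x0 \<in> A" by auto
    show FG: "F (G A) = A"
    proof (rule set_eqI)
      fix x
      show "x \<in> F (G A) \<longleftrightarrow> x \<in> A"
      proof (cases "x \<in> {1..n}")
        case x: True
        show ?thesis
        proof (cases "c x = c x0")
          case True
          then show ?thesis using compat_iff[OF A(1) x x0 True] A(2) x by (auto simp: F_def)
        next
          case False
          have "c x \<in> G A \<longleftrightarrow> (x \<in> A) = d x"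
          proof
            assume "c x \<in> G A"
            then obtain y where "y \<in> {1..n}" "c y = c x" "(y \<in> A) = d y"
              unfolding G_def by blast
            then show "(x \<in> A) = d x" using compat_iff[OF A(1) x, of y] by auto
          qed (use x False in \<open>auto simp: G_def\<close>)
          then show ?thesis using x False by (auto simp: F_def)
        qed
      next
        case False
        then show ?thesis using compat_subset[OF A(1)] by (auto simp: F_def)
      qed
    qed
    show "G A \<in> Pow ?I" by (auto simp: G_def)
    show "z ^ (n - card (F (G A))) = z ^ (n - card A)" by (simp add: FG)
  next
    fix T assume T: "T \<in> Pow ?I"
    show "G (F T) = T"
    proof (rule set_eqI)
      fix i
      show "i \<in> G (F T) \<longleftrightarrow> i \<in> T"
        using T by (cases "i \<in> ?I") (auto simp: G_def F_def)
    qed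
    show "F T \<in> {A. A \<in> compat n c d \<and> x0 \<in> A}"
      using x0 by (auto simp: F_def compat_def)
  qed
  also have "\<dots> = (\<Sum>T\<in>Pow ?I. z ^ p * ((\<Prod>i\<in>T. z ^ a i) * (\<Prod>i\<in>?I - T. z ^ b i)))"
  proof (rule sum.cong[OF refl])
    fix T assume "T \<in> Pow ?I"
    then have T: "T \<subseteq> ?I" by simp
    have "(\<Sum>i\<in>?I. if i \<in> T then a i else b i) = (\<Sum>i\<in>T. a i) + (\<Sum>i\<in>?I - T. b i)"
      using T by (subst sum.subset_diff[OF T]) (auto simp: add.commute intro!: sum.cong)
    then show "z ^ (n - card (F T)) = z ^ p * ((\<Prod>i\<in>T. z ^ a i) * (\<Prod>i\<in>?I - T. z ^ b i))"
      unfolding spies[OF T] by (simp add: power_add power_sum)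
  qed
  also have "\<dots> = z ^ p * (\<Prod>i\<in>?I. z ^ a i + z ^ b i)"
    by (subst prod_add) (auto simp: sum_distrib_left)
  finally show ?thesis by (simp add: a_def b_def p_def)
qed

section \<open>Signed weights and their sums\<close>

text \<open>With \<open>s = n - k\<close> and \<open>j\<close> spies this is \<open>(-1) ^ j\<close>
  times the coefficient of \<open>X ^ (s - j)\<close> in \<open>(1 - X) ^ - (2 * k - n)\<close>, and
  0 if \<open>j > s\<close>. As a single coefficient extraction it can be summed at the level of
  power series.\<close>

definition signed_weight :: "nat \<Rightarrow> nat \<Rightarrow> nat set \<Rightarrow> int" where
  "signed_weight n k A = fps_nth ((- fps_X) ^ (n - card A) * geometric_fps ^ (2 * k - n)) (n - k)"

lemma signed_weight_eq_0: "card A < k \<Longrightarrow> k \<le> n \<Longrightarrow> signed_weight n k A = 0"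
  unfolding signed_weight_def
  by (subst power_minus) (simp add: mult.assoc fps_X_power_mult_nth fps_mult_of_int_nth minus_one_power_iff)

text \<open>The complement of a compatible set containing \<open>x0\<close> is compatible and lacks
  \<open>x0\<close>, so it has fewer than \<open>k\<close> members; this bounds the degree of the
  generating polynomial. Each component other than that of \<open>x0\<close> supplies one level of
  the filtration.\<close>

lemma knight_component_dvd:
  assumes "n < 2 * k" "k \<le> n" "x0 \<in> {1..n}"
    and knight: "\<And>A. A \<in> compat n c d \<Longrightarrow> k \<le> card A \<Longrightarrow> x0 \<in> A"
  shows "2 ^ (comps n c - (2 * k - n)) dvd (\<Sum>A | A \<in> compat n c d \<and> x0 \<in> A. signed_weight n k A)"
proof -
  let ?S = "{A. A \<in> compat n c d \<and> x0 \<in> A}"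
  define P where "P = (\<Sum>A\<in>?S. [:-1, 1 :: int:] ^ (n - card A))"
  \<comment> \<open>Each power of \<open>z - 1\<close> takes the value 1 or -1 at 0.\<close>
  have "even (coeff ([:-1, 1 :: int:] ^ i + [:-1, 1:] ^ j) 0)" for i j
    by (simp add: coeff_0_power)
  then have "filtered (card (c ` {1..n} - {c x0})) P"
    unfolding P_def sum_compat_prod[OF assms(3)]
    by (subst mult.commute) (intro filtered_mult filtered_prod; simp)
  moreover have "Suc (card (c ` {1..n} - {c x0})) = comps n c"
    unfolding comps_def using assms(3) by (intro card_Suc_Diff1) auto
  moreover have "degree P < (n - k) + (2 * k - n)"
    unfolding P_def
  proof (rule degree_sum_less)
    fix A assume "A \<in> ?S"
    then have A: "A \<in> compat n c d" "x0 \<in> A" by auto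
    have "\<not> k \<le> card ({1..n} - A)"
      using knight[OF compat_complement[OF A(1)]] A(2) by blast
    then have "n - card A < k"
      using compat_subset[OF A(1)] by (simp add: card_Diff_subset finite_subset)
    then show "degree ([:-1, 1 :: int:] ^ (n - card A)) < (n - k) + (2 * k - n)"
      using assms(1,2) by (simp add: degree_linear_power)
  qed (use assms in auto)
  ultimately have "2 ^ (comps n c - (2 * k - n)) dvd
      fps_nth (expand_at_1 P * geometric_fps ^ (2 * k - n)) (n - k)"
    by (metis filtered_imp_coeff_dvd)
  also have "fps_nth (expand_at_1 P * geometric_fps ^ (2 * k - n)) (n - k) = (\<Sum>A\<in>?S. signed_weight n k A)"
    by (simp add: P_def expand_at_1_sum expand_at_1_power sum_distrib_right fps_sum_nth signed_weight_def)
  finally show ?thesis .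
qed

lemma sum_Pow_power_card_diff:
  fixes z :: "'a :: comm_ring_1"
  assumes "finite X"
  shows "(\<Sum>A\<in>Pow X. z ^ card (X - A)) = (1 + z) ^ card X"
  using prod_add[OF assms, of "\<lambda>_. 1" "\<lambda>_. z"] by simp

text \<open>Summing over all sets gives \<open>(1 - X) ^ n\<close>, and division by
  \<open>(1 - X) ^ (2 * k - n)\<close> leaves the exponent \<open>2 * (n - k)\<close>.\<close>

lemma sum_signed_weight:
  assumes "n < 2 * k" "k \<le> n"
  shows "(\<Sum>A\<in>Pow {1..n}. signed_weight n k A) = (-1) ^ (n - k) * int (2 * (n - k) choose (n - k))"
proof -
  have "(\<Sum>A\<in>Pow {1..n}. (- fps_X :: int fps) ^ (n - card A)) = (1 - fps_X) ^ n"
    using sum_Pow_power_card_diff[of "{1..n}" "- fps_X :: int fps"]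
    by (simp add: card_Diff_subset finite_subset)
  then have "(\<Sum>A\<in>Pow {1..n}. signed_weight n k A) =
      fps_nth ((1 - fps_X) ^ n * geometric_fps ^ (2 * k - n)) (n - k)"
    by (simp only: signed_weight_def fps_sum_nth[symmetric] sum_distrib_right[symmetric])
  also have "(1 - fps_X) ^ n * geometric_fps ^ (2 * k - n) = (1 - fps_X) ^ (2 * (n - k))"
  proof -
    have "\<not> n < 2 * k - n" "n - (2 * k - n) = 2 * (n - k)" using assms by linarith+
    then show ?thesis by (simp add: power_mult_geometric_fps_power)
  qed
  finally show ?thesis by (simp add: fps_nth_one_minus_X_power)
qed

text \<open>Fixing Person 1 as a knight costs one factor \<open>1 - X\<close>, which halves the
  resulting binomial coefficient.\<close>

lemma sum_signed_weight_knight: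
  assumes "n < 2 * k" "k < n"
  shows "2 * (\<Sum>A | A \<in> Pow {1..n} \<and> 1 \<in> A. signed_weight n k A) =
    (-1) ^ (n - k) * int (2 * (n - k) choose (n - k))"
proof -
  let ?Y = "{1..n} - {1}"
  have eq: "{A. A \<in> Pow {1..n} \<and> 1 \<in> A} = insert 1 ` Pow ?Y"
  proof (intro equalityI subsetI)
    fix A assume "A \<in> {A. A \<in> Pow {1..n} \<and> 1 \<in> A}"
    then show "A \<in> insert 1 ` Pow ?Y" by (intro image_eqI[of _ _ "A - {1}"]) auto
  qed (use assms in auto)
  have "(\<Sum>A | A \<in> Pow {1..n} \<and> 1 \<in> A. (- fps_X :: int fps) ^ (n - card A)) =
      (\<Sum>B\<in>Pow ?Y. (- fps_X) ^ (n - card (insert 1 B)))"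
    unfolding eq by (subst sum.reindex) (auto simp: inj_on_def)
  also have "\<dots> = (\<Sum>B\<in>Pow ?Y. (- fps_X) ^ card (?Y - B))"
  proof (intro sum.cong refl arg_cong[of _ _ "(^) _"])
    fix B assume B: "B \<in> Pow ?Y"
    then have "finite B" using finite_subset by blast
    then show "n - card (insert 1 B) = card (?Y - B)"
      using B assms by (subst card_insert_disjoint) (auto simp: card_Diff_subset)
  qed
  also have "\<dots> = (1 - fps_X) ^ (n - 1)"
    using sum_Pow_power_card_diff[of ?Y "- fps_X :: int fps"] assms by simp
  finally have "(\<Sum>A | A \<in> Pow {1..n} \<and> 1 \<in> A. signed_weight n k A) =
      fps_nth ((1 - fps_X) ^ (n - 1) * geometric_fps ^ (2 * k - n)) (n - k)"
    by (simp only: signed_weight_def fps_sum_nth[symmetric] sum_distrib_right[symmetric])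
  also have "(1 - fps_X) ^ (n - 1) * geometric_fps ^ (2 * k - n) = (1 - fps_X) ^ (2 * (n - k) - 1)"
  proof -
    have "\<not> n - 1 < 2 * k - n" "n - 1 - (2 * k - n) = 2 * (n - k) - 1" using assms by linarith+
    then show ?thesis by (simp add: power_mult_geometric_fps_power)
  qed
  finally have *: "(\<Sum>A | A \<in> Pow {1..n} \<and> 1 \<in> A. signed_weight n k A) =
      (-1) ^ (n - k) * int ((2 * (n - k) - 1) choose (n - k))"
    by (simp add: fps_nth_one_minus_X_power)
  \<comment> \<open>As \<open>n - k\<close> is positive, Pascal's rule splits the central
    coefficient into two equal ones.\<close>
  obtain j where j: "n - k = Suc j" using assms by (metis Suc_diff_Suc)
  have "(Suc (2 * j) choose j) = (Suc (2 * j) choose Suc j)"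
    using binomial_symmetric[of j "Suc (2 * j)"] by simp
  then have "(2 * (n - k)) choose (n - k) = 2 * ((2 * (n - k) - 1) choose (n - k))"
    by (simp add: j)
  then show ?thesis unfolding * by simp
qed

section \<open>Lower bounds\<close>

lemma lying_spies_iff: "lying_spies A x y a \<longleftrightarrow> a = ((x \<in> A) \<noteq> (y \<in> A))"
  by (auto simp: lying_spies_def)

section \<open>The adversary argument\<close>

text \<open>An answer inside a component is forced and changes nothing. Otherwise the two answers
  split the sum into two positions with one component and one question fewer, so the exponent is the
  same for both and passes to the whole. The parameter \<open>b\<close> limits how few components a
  leaf can have.\<close>

lemma adversary_dvd:
  fixes w :: "nat set \<Rightarrow> int"
  assumes leaf: "\<And>c d r. n \<le> comps n c + b \<Longrightarrow> (\<And>A. A \<in> compat n c d \<inter> \<Omega> \<Longrightarrow> correct A r) \<Longrightarrow>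
      2 ^ (comps n c - \<delta>) dvd (\<Sum>A\<in>compat n c d. w A)"
    and "permitted n t" "accomplishes lying_spies (compat n c d \<inter> \<Omega>) correct t q"
    and "n + q \<le> comps n c + b"
  shows "2 ^ (comps n c - \<delta> - q) dvd (\<Sum>A\<in>compat n c d. w A)"
  using assms(2-)
proof (induction t arbitrary: c d q)
  case (Announce r)
  then have "2 ^ (comps n c - \<delta>) dvd (\<Sum>A\<in>compat n c d. w A)"
    by (intro leaf[of c d r]) auto
  then show ?case by (rule power_le_dvd) simp
next
  case (Ask x y s t)
  then have xy: "x \<in> {1..n}" "y \<in> {1..n}" "permitted n s" "permitted n t" by auto
  show ?case
  proof (cases q)
    case 0
    \<comment> \<open>A question beyond the budget is possible only if no situation is left; the
      leaf condition then holds vacuously for any announcement.\<close>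
    then have "compat n c d \<inter> \<Omega> = {}"
      using Ask.prems(2) accomplishes_Ask_0 by blast
    then have "2 ^ (comps n c - \<delta>) dvd (\<Sum>A\<in>compat n c d. w A)"
      using Ask.prems(3) by (intro leaf[of c d undefined]) auto
    then show ?thesis by (rule power_le_dvd) simp
  next
    case (Suc p)
    have acc:
      "accomplishes lying_spies {A \<in> compat n c d \<inter> \<Omega>. (x \<in> A) \<noteq> (y \<in> A)} correct s p"
      "accomplishes lying_spies {A \<in> compat n c d \<inter> \<Omega>. (x \<in> A) = (y \<in> A)} correct t p"
    proof -
      have "{A \<in> compat n c d \<inter> \<Omega>. lying_spies A x y True} = {A \<in> compat n c d \<inter> \<Omega>. (x \<in> A) \<noteq> (y \<in> A)}"
        "{A \<in> compat n c d \<inter> \<Omega>. lying_spies A x y False} = {A \<in> compat n c d \<inter> \<Omega>. (x \<in> A) = (y \<in> A)}"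
        by (auto simp: lying_spies_iff)
      then show
        "accomplishes lying_spies {A \<in> compat n c d \<inter> \<Omega>. (x \<in> A) \<noteq> (y \<in> A)} correct s p"
        "accomplishes lying_spies {A \<in> compat n c d \<inter> \<Omega>. (x \<in> A) = (y \<in> A)} correct t p"
        using Ask.prems(2) by (simp_all only: Suc accomplishes_Ask)
    qed
    show ?thesis
    proof (cases "c x = c y")
      case True
      have "((x \<in> A) = (y \<in> A)) = (d x = d y)" if "A \<in> compat n c d" for A
        using compat_iff[OF that xy(1,2) True] .
      then have
        "d x \<noteq> d y \<Longrightarrow> {A \<in> compat n c d \<inter> \<Omega>. (x \<in> A) \<noteq> (y \<in> A)} = compat n c d \<inter> \<Omega>"
        "d x = d y \<Longrightarrow> {A \<in> compat n c d \<inter> \<Omega>. (x \<in> A) = (y \<in> A)} = compat n c d \<inter> \<Omega>"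
        by blast+
      then have "accomplishes lying_spies (compat n c d \<inter> \<Omega>) correct s p \<or>
          accomplishes lying_spies (compat n c d \<inter> \<Omega>) correct t p"
        using acc by metis
      then have "2 ^ (comps n c - \<delta> - p) dvd (\<Sum>A\<in>compat n c d. w A)"
        using Ask.IH(1)[OF xy(3), of c d p] Ask.IH(2)[OF xy(4), of c d p] Ask.prems(3) Suc by auto
      then show ?thesis by (rule power_le_dvd) (simp add: Suc)
    next
      case False
      obtain c1 d1 where 1: "compat n c1 d1 = {A \<in> compat n c d. ((x \<in> A) = (y \<in> A)) = False}"
          "Suc (comps n c1) = comps n c"
        by (rule compat_refine[OF xy(1,2) False])
      obtain c2 d2 where 2: "compat n c2 d2 = {A \<in> compat n c d. ((x \<in> A) = (y \<in> A)) = True}"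
          "Suc (comps n c2) = comps n c"
        by (rule compat_refine[OF xy(1,2) False])
      have "compat n c1 d1 \<inter> \<Omega> = {A \<in> compat n c d \<inter> \<Omega>. (x \<in> A) \<noteq> (y \<in> A)}"
        "compat n c2 d2 \<inter> \<Omega> = {A \<in> compat n c d \<inter> \<Omega>. (x \<in> A) = (y \<in> A)}"
        unfolding 1 2 by blast+
      then have "2 ^ (comps n c1 - \<delta> - p) dvd (\<Sum>A\<in>compat n c1 d1. w A)"
        "2 ^ (comps n c2 - \<delta> - p) dvd (\<Sum>A\<in>compat n c2 d2. w A)"
        using acc Ask.IH(1)[OF xy(3), of c1 d1 p] Ask.IH(2)[OF xy(4), of c2 d2 p]
          Ask.prems(3) Suc 1(2) 2(2) by auto
      moreover have "comps n c1 - \<delta> - p = comps n c - \<delta> - q" "comps n c2 - \<delta> - p = comps n c - \<delta> - q"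
        using Suc 1(2) 2(2) by linarith+
      ultimately have "2 ^ (comps n c - \<delta> - q) dvd
          (\<Sum>A\<in>compat n c1 d1. w A) + (\<Sum>A\<in>compat n c2 d2. w A)"
        by (metis dvd_add)
      also have "\<dots> = (\<Sum>A\<in>compat n c1 d1 \<union> compat n c2 d2. w A)"
        by (rule sum.union_disjoint[symmetric]) (auto simp: finite_compat 1 2)
      also have "compat n c1 d1 \<union> compat n c2 d2 = compat n c d"
        unfolding 1 2 by blast
      finally show ?thesis .
    qed
  qed
qed

lemma adversary_dvd_initial:
  fixes w :: "nat set \<Rightarrow> int"
  assumes "\<And>c d r. n \<le> comps n c + q \<Longrightarrow> (\<And>A. A \<in> compat n c d \<inter> \<Omega> \<Longrightarrow> correct A r) \<Longrightarrow>
      2 ^ (comps n c - \<delta>) dvd (\<Sum>A\<in>compat n c d. w A)"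
    and "permitted n t" "accomplishes lying_spies \<Omega> correct t q"
  shows "2 ^ (n - \<delta> - q) dvd (\<Sum>A\<in>Pow {1..n}. w A)"
proof -
  have "2 ^ (comps n id - \<delta> - q) dvd (\<Sum>A\<in>compat n id (\<lambda>_. True). w A)"
  proof (rule adversary_dvd[where b = q and correct = correct and \<Omega> = \<Omega>])
    show "accomplishes lying_spies (compat n id (\<lambda>_. True) \<inter> \<Omega>) correct t q"
      using assms(3) by (rule accomplishes_mono) auto
    show "2 ^ (comps n c - \<delta>) dvd (\<Sum>A\<in>compat n c d. w A)"
      if "n \<le> comps n c + q" "\<And>A. A \<in> compat n c d \<inter> \<Omega> \<Longrightarrow> correct A r" for c d r
      using that by (rule assms(1))
    show "n + q \<le> comps n id + q" by (simp add: comps_def)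
  qed fact
  then show ?thesis by (simp add: comps_def compat_discrete)
qed

text \<open>Compatibility of the full set makes every component one-sided, so a set missing
  \<open>x\<close> misses its whole component.\<close>

lemma compat_remove_component:
  assumes full: "{1..n} \<in> compat n c d" and A: "A \<in> compat n c d" "x \<in> {1..n}" "x \<notin> A"
  shows "{z \<in> {1..n}. c z \<noteq> c x} \<in> compat n c d" "card A \<le> card {z \<in> {1..n}. c z \<noteq> c x}"
proof -
  show "{z \<in> {1..n}. c z \<noteq> c x} \<in> compat n c d"
    using compat_flip_component[OF full, of "c x"] by (simp cong: conj_cong)
  have "c z \<noteq> c x" if "z \<in> A" for z
    using compat_iff[OF A(1), of z x] compat_iff[OF full, of z x] compat_subset[OF A(1)] A(2,3) that
    by auto
  then show "card A \<le> card {z \<in> {1..n}. c z \<noteq> c x}"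
    using compat_subset[OF A(1)] by (intro card_mono) auto
qed

section \<open>From a known identity to a known knight\<close>

lemma situations_with_spy_iff:
  "A \<subseteq> {1..n} \<Longrightarrow> A \<in> situations_with_spy n k \<longleftrightarrow> k \<le> card A \<and> A \<noteq> {1..n}"
  by (auto simp: situations_with_spy_def situations_def)

text \<open>Makes \<open>knight_component_dvd\<close> applicable at leaves where only a spy is
  known, and extends the knowledge to the full set, which the promise of a spy excludes.\<close>

lemma known_identity_imp_known_knight:
  assumes "0 < k" and A0: "A0 \<in> compat n c d" "k \<le> card A0" and x: "x \<in> {1..n}"
    and known: "\<And>A. A \<in> compat n c d \<inter> situations_with_spy n k \<Longrightarrow> b = (x \<in> A)"
  obtains y where "y \<in> {1..n}" "\<And>A. A \<in> compat n c d \<Longrightarrow> k \<le> card A \<Longrightarrow> y \<in> A"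
proof -
  have "\<exists>y\<in>{1..n}. \<forall>A\<in>compat n c d. k \<le> card A \<longrightarrow> y \<in> A"
  proof (rule ccontr)
    assume "\<not> ?thesis"
    then have no: "\<exists>A\<in>compat n c d. k \<le> card A \<and> y \<notin> A" if "y \<in> {1..n}" for y
      using that by blast
    have known': "b = (x \<in> A)" if "A \<in> compat n c d" "k \<le> card A" "A \<noteq> {1..n}" for A
      using that known[of A] compat_subset[OF that(1)] by (auto simp: situations_with_spy_iff)
    show False
    proof (cases "{1..n} \<in> compat n c d")
      \<comment> \<open>If nobody is a certain knight, each component may consist of the only spies.
        Then \<open>x\<close> is a spy when its own component does, and a knight when another one
        does.\<close>
      case True
      have B: "{z \<in> {1..n}. c z \<noteq> c y} \<in> compat n c d" "k \<le> card {z \<in> {1..n}. c z \<noteq> c y}"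
        if "y \<in> {1..n}" for y
        using no[OF that] compat_remove_component[OF True _ that] by force+
      have "{z \<in> {1..n}. c z \<noteq> c x} \<noteq> {}"
        using B(2)[OF x] \<open>0 < k\<close> by (metis card.empty not_le)
      then obtain y where y: "y \<in> {1..n}" "c y \<noteq> c x" by blast
      have "\<not> b" using known'[OF B[OF x]] x by blast
      moreover have "x \<in> {z \<in> {1..n}. c z \<noteq> c y}" using x y by auto
      moreover have "{z \<in> {1..n}. c z \<noteq> c y} \<noteq> {1..n}" using y by blast
      ultimately have "\<not> b \<and> b" using known'[OF B[OF y(1)]] by metis
      then show False by blast
    next
      case False
      then have fixed: "b = (x \<in> A)" if "A \<in> compat n c d" "k \<le> card A" for A
        using that known' by blast
      show False
      proof (cases b)
        case True
        then show False using no[OF x] fixed by blast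
      next
        case False
        show False
        proof (cases "\<exists>y\<in>A0. c y = c x")
          \<comment> \<open>A person on the side opposite to \<open>x\<close> is a knight whenever
            \<open>x\<close> is a spy.\<close>
          case True
          then obtain y where y: "y \<in> A0" "c y = c x" by blast
          have y': "y \<in> {1..n}" using y compat_subset[OF A0(1)] by blast
          obtain A where A: "A \<in> compat n c d" "k \<le> card A" "y \<notin> A" using no[OF y'] by blast
          show False
            using compat_iff[OF A(1) y' x y(2)] compat_iff[OF A0(1) y' x y(2)]
              fixed[OF A(1,2)] fixed[OF A0] A(3) y(1) False by blast
        next
          \<comment> \<open>In \<open>A0\<close> the whole component of \<open>x\<close> consists of
            spies; flipping it only adds knights but changes the kind of \<open>x\<close>.\<close>
          case notin: False
          let ?A = "{z \<in> {1..n}. (z \<in> A0) \<noteq> (c z = c x)}"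
          have "card A0 \<le> card ?A"
            using compat_subset[OF A0(1)] notin by (intro card_mono) auto
          then have "b = (x \<in> ?A)"
            using A0 compat_flip_component[OF A0(1)] by (intro fixed) auto
          then show False using False x fixed[OF A0] by auto
        qed
      qed
    qed
  qed
  then show ?thesis using that by blast
qed

lemma sum_signed_weight_knight_eq:
  assumes "k \<le> n" and "\<And>A. A \<in> compat n c d \<Longrightarrow> k \<le> card A \<Longrightarrow> y \<in> A"
  shows "(\<Sum>A\<in>compat n c d. signed_weight n k A) =
    (\<Sum>A | A \<in> compat n c d \<and> y \<in> A. signed_weight n k A)"
proof (rule sum.mono_neutral_right[OF finite_compat])
  show "\<forall>A\<in>compat n c d - {A. A \<in> compat n c d \<and> y \<in> A}. signed_weight n k A = 0"
  proof
    fix A assume "A \<in> compat n c d - {A. A \<in> compat n c d \<and> y \<in> A}"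
    then have "\<not> k \<le> card A" using assms(2)[of A] by blast
    then show "signed_weight n k A = 0" using assms(1) by (simp add: signed_weight_eq_0)
  qed
qed auto

text \<open>The map \<open>g\<close> reads an identity off an announcement, so that the bound covers
  knights, arbitrary identities and the exceptional case of Person 1.\<close>

lemma identity_lower_bound:
  assumes nk: "n < 2 * k" "k < n"
    and correct: "\<And>A r. A \<subseteq> {1..n} \<Longrightarrow> correct A r \<Longrightarrow> is_identity n A (g r)"
    and t: "permitted n t" "accomplishes lying_spies (situations_with_spy n k) correct t q"
  shows "2 * (n - k) - binary_ones (n - k) \<le> q"
proof -
  have "2 ^ (n - (2 * k - n) - q) dvd (\<Sum>A\<in>Pow {1..n}. signed_weight n k A)"
  proof (rule adversary_dvd_initial[OF _ t])
    fix c d r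
    assume r: "\<And>A. A \<in> compat n c d \<inter> situations_with_spy n k \<Longrightarrow> correct A r"
    show "2 ^ (comps n c - (2 * k - n)) dvd (\<Sum>A\<in>compat n c d. signed_weight n k A)"
    proof (cases "\<exists>y\<in>{1..n}. \<forall>A\<in>compat n c d. k \<le> card A \<longrightarrow> y \<in> A")
      case True
      then obtain y where y: "y \<in> {1..n}" "\<And>A. A \<in> compat n c d \<Longrightarrow> k \<le> card A \<Longrightarrow> y \<in> A"
        by blast
      then show ?thesis
        using nk knight_component_dvd[OF nk(1) _ y] sum_signed_weight_knight_eq[of k n c d y] by simp
    next
      case False
      \<comment> \<open>Without a certain knight no compatible set has \<open>k\<close> members, so
        all weights vanish.\<close>
      have "card A < k" if "A \<in> compat n c d" for A
      proof (rule ccontr)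
        assume "\<not> card A < k"
        then have A: "A \<in> compat n c d" "k \<le> card A" using that by auto
        \<comment> \<open>The default 1 matters only if no situation is consistent, as then
          \<open>g r\<close> may name nobody in range.\<close>
        define x where "x = (if fst (g r) \<in> {1..n} then fst (g r) else 1)"
        have "snd (g r) = (x \<in> A)" if "A \<in> compat n c d \<inter> situations_with_spy n k" for A
        proof -
          have "A \<subseteq> {1..n}" using that compat_subset by blast
          then have "is_identity n A (g r)" by (rule correct[OF _ r[OF that]])
          then show ?thesis by (auto simp: is_identity_def x_def split: prod.splits)
        qed
        moreover have "x \<in> {1..n}" using nk by (auto simp: x_def)
        ultimately show False
          using known_identity_imp_known_knight[OF _ A, of x "snd (g r)"] False nk by (metis gr0I less_nat_zero_code mult_0_right)
      qed
      then show ?thesis using nk by (simp add: signed_weight_eq_0)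
    qed
  qed
  moreover have "n - (2 * k - n) = 2 * (n - k)" using nk by linarith
  ultimately have "2 ^ (2 * (n - k) - q) dvd (\<Sum>A\<in>Pow {1..n}. signed_weight n k A)" by metis
  then have "2 ^ (2 * (n - k) - q) dvd int (2 * (n - k) choose (n - k))"
    unfolding sum_signed_weight[OF nk(1) less_imp_le[OF nk(2)]]
    by (simp add: minus_one_power_iff split: if_splits)
  then have "2 ^ (2 * (n - k) - q) dvd (2 * (n - k) choose (n - k))"
    by (metis of_nat_dvd_iff of_nat_numeral of_nat_power)
  then have "\<not> binary_ones (n - k) < 2 * (n - k) - q"
    using not_power_dvd_central_binomial by blast
  then show ?thesis by linarith
qed

section \<open>Lower bounds for Person 1\<close>

text \<open>A leaf that knows Person 1 as a spy contributes 0, and halving the total gains one in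
  the exponent, hence the strict bound. The assumption \<open>known\<close> carries a leaf's
  knowledge from \<open>\<Omega>\<close> over to all sets with at least \<open>k\<close>
  knights.\<close>

lemma nominee_lower_bound:
  assumes nk: "n < 2 * k" "k < n"
    and t: "permitted n t" "accomplishes lying_spies \<Omega> (is_identity_of 1) t q"
    and known: "\<And>c d b. n \<le> comps n c + q \<Longrightarrow> (\<And>A. A \<in> compat n c d \<inter> \<Omega> \<Longrightarrow> b = (1 \<in> A)) \<Longrightarrow>
      \<exists>b'. \<forall>A\<in>compat n c d. k \<le> card A \<longrightarrow> b' = (1 \<in> A)"
  shows "2 * (n - k) - binary_ones (n - k) < q"
proof (rule ccontr)
  assume less: "\<not> ?thesis"
  let ?w = "\<lambda>A. if 1 \<in> A then signed_weight n k A else 0"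
  have "2 ^ (n - (2 * k - n) - q) dvd (\<Sum>A\<in>Pow {1..n}. ?w A)"
  proof (rule adversary_dvd_initial[OF _ t])
    fix c d r
    assume "n \<le> comps n c + q"
      and "\<And>A. A \<in> compat n c d \<inter> \<Omega> \<Longrightarrow> is_identity_of 1 A r"
    then obtain b where b: "\<And>A. A \<in> compat n c d \<Longrightarrow> k \<le> card A \<Longrightarrow> b = (1 \<in> A)"
      using known[of c d r] unfolding is_identity_of_def by blast
    have eq: "(\<Sum>A\<in>compat n c d. ?w A) = (\<Sum>A | A \<in> compat n c d \<and> 1 \<in> A. signed_weight n k A)"
      by (simp add: sum.If_cases finite_compat Int_def)
    show "2 ^ (comps n c - (2 * k - n)) dvd (\<Sum>A\<in>compat n c d. ?w A)"
    proof (cases b)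
      case True
      then show ?thesis
        unfolding eq using nk b by (intro knight_component_dvd) auto
    next
      case False
      have "signed_weight n k A = 0" if "A \<in> compat n c d" "1 \<in> A" for A
        using that b[of A] False nk by (intro signed_weight_eq_0) (auto simp flip: not_le)
      then show ?thesis unfolding eq by simp
    qed
  qed
  moreover have "(\<Sum>A\<in>Pow {1..n}. ?w A) = (\<Sum>A | A \<in> Pow {1..n} \<and> 1 \<in> A. signed_weight n k A)"
    by (simp add: sum.If_cases Int_def)
  moreover have "n - (2 * k - n) = 2 * (n - k)" using nk by linarith
  ultimately have "2 * 2 ^ (2 * (n - k) - q) dvd
      2 * (\<Sum>A | A \<in> Pow {1..n} \<and> 1 \<in> A. signed_weight n k A)"
    by (metis mult_dvd_mono dvd_refl)
  then have "2 ^ Suc (2 * (n - k) - q) dvd int (2 * (n - k) choose (n - k))"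
    unfolding sum_signed_weight_knight[OF nk] by (simp add: minus_one_power_iff split: if_splits)
  then have "2 ^ Suc (2 * (n - k) - q) dvd (2 * (n - k) choose (n - k))"
    by (metis of_nat_dvd_iff of_nat_numeral of_nat_power)
  then have "\<not> binary_ones (n - k) < Suc (2 * (n - k) - q)"
    using not_power_dvd_central_binomial by blast
  \<comment> \<open>Rules out truncation in
    \<open>2 * (n - k) - binary_ones (n - k)\<close>.\<close>
  moreover have "binary_ones (n - k) \<le> n - k" using multiplicity_2_fact[of "n - k"] by linarith
  ultimately show False using less by linarith
qed

lemma nominee_lower_bound_lying:
  assumes "n < 2 * k" "k < n"
    and "permitted n t" "accomplishes lying_spies (situations n k) (is_identity_of 1) t q"
  shows "2 * (n - k) - binary_ones (n - k) < q"
  using assms(1-4)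
proof (rule nominee_lower_bound)
  fix c d b assume b: "\<And>A. A \<in> compat n c d \<inter> situations n k \<Longrightarrow> b = (1 \<in> A)"
  have "b = (1 \<in> A)" if "A \<in> compat n c d" "k \<le> card A" for A
    using that compat_subset[OF that(1)] by (intro b) (auto simp: situations_def)
  then show "\<exists>b'. \<forall>A\<in>compat n c d. k \<le> card A \<longrightarrow> b' = (1 \<in> A)" by blast
qed

text \<open>The promise of a spy helps a leaf only if the full set is compatible and Person 1 is a
  spy in all other sets with at least \<open>k\<close> knights. Reaching such a leaf takes too many
  questions unless the parameters are exceptional.\<close>

lemma nominee_lower_bound_lying_with_spy:
  assumes nk: "n < 2 * k" "k < n"
    and t: "permitted n t" "accomplishes lying_spies (situations_with_spy n k) (is_identity_of 1) t q"
    and unexceptional: "\<not> (\<exists>e. n = 2 ^ (e + 1) + 1 \<and> k = 2 ^ e + 1)"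
  shows "2 * (n - k) - binary_ones (n - k) < q"
proof (rule ccontr)
  assume q: "\<not> ?thesis"
  have "2 * (n - k) - binary_ones (n - k) < q"
    using nk t
  proof (rule nominee_lower_bound)
    fix c d b
    assume comps: "n \<le> comps n c + q"
      and b: "\<And>A. A \<in> compat n c d \<inter> situations_with_spy n k \<Longrightarrow> b = (1 \<in> A)"
    have known: "b = (1 \<in> A)" if "A \<in> compat n c d" "k \<le> card A" "A \<noteq> {1..n}" for A
      using that b[of A] compat_subset[OF that(1)] by (auto simp: situations_with_spy_iff)
    have 1: "1 \<in> {1..n}" using nk by auto
    show "\<exists>b'. \<forall>A\<in>compat n c d. k \<le> card A \<longrightarrow> b' = (1 \<in> A)"
    proof (rule ccontr)
      assume no: "\<not> ?thesis"
      have full: "{1..n} \<in> compat n c d" using known no by metis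
      have "\<not> b" using known no 1 by metis
      obtain A where A: "A \<in> compat n c d" "k \<le> card A" "1 \<notin> A" using no by metis
      \<comment> \<open>A component of at most \<open>n - k\<close> people could consist of the only
        spies, with Person 1 a knight.\<close>
      have large: "n - k < card {z \<in> {1..n}. c z = i}" if i: "i \<in> c ` {1..n} - {c 1}" for i
      proof -
        let ?B = "{z \<in> {1..n}. c z \<noteq> i}"
        have "?B \<in> compat n c d"
          using compat_flip_component[OF full, of i] by (simp cong: conj_cong)
        moreover have "1 \<in> ?B" "?B \<noteq> {1..n}" using i 1 by auto
        ultimately have "\<not> k \<le> card ?B" using known \<open>\<not> b\<close> by blast
        moreover have "card ?B + card {z \<in> {1..n}. c z = i} = card (?B \<union> {z \<in> {1..n}. c z = i})"
          by (rule card_Un_disjoint[symmetric]) auto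
        moreover have "?B \<union> {z \<in> {1..n}. c z = i} = {1..n}" by blast
        ultimately show ?thesis using nk by (simp; linarith)
      qed
      have "{1..n} = (\<Union>i\<in>c ` {1..n}. {z \<in> {1..n}. c z = i})" by auto
      then have "n = card (\<Union>i\<in>c ` {1..n}. {z \<in> {1..n}. c z = i})" by simp
      also have "\<dots> = (\<Sum>i\<in>c ` {1..n}. card {z \<in> {1..n}. c z = i})"
        by (rule card_UN_disjoint) auto
      also have "\<dots> = card {z \<in> {1..n}. c z = c 1} + (\<Sum>i\<in>c ` {1..n} - {c 1}. card {z \<in> {1..n}. c z = i})"
        using 1 by (intro sum.remove) auto
      finally have "n = card {z \<in> {1..n}. c z = c 1} + (\<Sum>i\<in>c ` {1..n} - {c 1}. card {z \<in> {1..n}. c z = i})" .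
      moreover have "of_nat (card (c ` {1..n} - {c 1})) * Suc (n - k) \<le>
          (\<Sum>i\<in>c ` {1..n} - {c 1}. card {z \<in> {1..n}. c z = i})"
        using large by (intro sum_bounded_below) (simp add: Suc_le_eq)
      ultimately have n_ge: "card {z \<in> {1..n}. c z = c 1} + card (c ` {1..n} - {c 1}) * Suc (n - k) \<le> n"
        unfolding of_nat_id by linarith
      define m where "m = card (c ` {1..n} - {c 1})"
      have comps_m: "comps n c = Suc m"
        unfolding comps_def m_def using 1 by (intro card_Suc_Diff1[symmetric]) auto
      \<comment> \<open>By the sizes of the components \<open>n\<close> is at least
        \<open>1 + m * (n - k + 1)\<close>, and by their number at most
        \<open>m + 1 + q\<close>.\<close>
      have "0 < card {z \<in> {1..n}. c z = c 1}" using 1 by (auto simp: card_gt_0_iff)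
      then have "m * (n - k) \<le> q"
        using n_ge comps unfolding m_def[symmetric] comps_m mult_Suc_right by linarith
      moreover have ones: "0 < binary_ones (n - k)" using nk by (intro binary_ones_pos) simp
      moreover have "binary_ones (n - k) \<le> n - k" using multiplicity_2_fact[of "n - k"] by linarith
      ultimately have "m * (n - k) < 2 * (n - k)" using q by linarith
      then have "m < 2" by simp
      \<comment> \<open>Now \<open>n\<close> is squeezed between \<open>2 * (n - k) + 1\<close> and
        \<open>2 + q\<close>, which leaves only the exceptional parameters.\<close>
      then have "n \<le> 2 + q" using comps comps_m by simp
      then have "binary_ones (n - k) = 1" "n = Suc (2 * (n - k))"
        using q ones nk \<open>binary_ones (n - k) \<le> n - k\<close> by linarith+
      moreover obtain e where "n - k = 2 ^ e" using binary_ones_eq_1_imp_power calculation(1) by blast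
      ultimately have "n = 2 ^ (e + 1) + 1" "k = 2 ^ e + 1" using nk by auto
      then show False using unexceptional by blast
    qed
  qed
  then show False using q by blast
qed

text \<open>
  Unconstrained spies may answer like knights about everyone but themselves, so somebody about
  whom nobody was asked cannot be told from a knight while all answers are "no".
\<close>

lemma all_no_imp_knight:
  assumes "permitted n t" "finite Y" "card Y + q + 2 \<le> n"
    and "accomplishes unconstrained_spies {{1..n} - {x} | x. x \<in> {2..n} - Y} (is_identity_of 1) t q"
    and "run lying_spies {1..n} t r m"
  shows "r \<and> m \<le> q"
  using assms
proof (induction t arbitrary: Y q m)
  case (Announce r')
  \<comment> \<open>Someone other than Person 1 is still outside \<open>Y\<close>; if that one is
    the only spy, Person 1 is a knight.\<close>
  have "\<exists>x. x \<in> {2..n} - Y"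
  proof (rule ccontr)
    assume "\<not> ?thesis"
    then have "card {2..n} \<le> card Y" using Announce by (intro card_mono) auto
    then show False using Announce by simp
  qed
  then obtain x where x: "x \<in> {2..n} - Y" by blast
  then have "is_identity_of 1 ({1..n} - {x}) r'" using Announce.prems(4) by auto
  then show ?case using x Announce.prems(5) by (auto simp: is_identity_of_def)
next
  case (Ask u y s t)
  let ?\<Omega> = "\<lambda>Y. {{1..n} - {x} | x. x \<in> {2..n} - Y}"
  have u: "u \<in> {1..n}" "y \<in> {1..n}" "permitted n t" using Ask.prems(1) by auto
  then have "\<not> lying_spies {1..n} u y True" by (simp add: lying_spies_iff)
  then obtain p where p: "m = Suc p" "run lying_spies {1..n} t r p"
    using Ask.prems(5) by (auto simp: run_Ask_iff)
  have "q \<noteq> 0"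
  proof
    assume "q = 0"
    then have "{2..n} - Y = {}" using Ask.prems(4) accomplishes_Ask_0 by fastforce
    then have "card {2..n} \<le> card Y" using Ask.prems by (intro card_mono) auto
    then show False using Ask.prems(3) by simp
  qed
  then obtain q' where q': "q = Suc q'" by (cases q) auto
  \<comment> \<open>If the only spy is not \<open>y\<close>, then "no" is true and possible for
    everybody, so it suffices to record \<open>y\<close> in \<open>Y\<close>.\<close>
  have "?\<Omega> (insert y Y) \<subseteq> {A \<in> ?\<Omega> Y. unconstrained_spies A u y False}"
    using u by (auto simp: unconstrained_spies_def)
  then have "accomplishes unconstrained_spies (?\<Omega> (insert y Y)) (is_identity_of 1) t q'"
    using Ask.prems(4) unfolding q' accomplishes_Ask by (meson accomplishes_mono order_refl)
  moreover have "card (insert y Y) + q' + 2 \<le> n"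
    using Ask.prems(2,3) q' by (simp add: card_insert_if)
  ultimately have "r \<and> p \<le> q'" using Ask.IH(2)[OF u(3), of "insert y Y"] Ask.prems(2) p(2) by auto
  then show ?case using p q' by simp
qed

text \<open>By \<open>all_no_imp_knight\<close>, a strategy with too few questions would also be
  right when no spy is present, and so would succeed against lying spies without the
  promise.\<close>

lemma nominee_lower_bound_unconstrained_with_spy:
  assumes nk: "n < 2 * k" "k < n"
    and t: "permitted n t"
      "accomplishes unconstrained_spies (situations_with_spy n k) (is_identity_of 1) t q"
  shows "2 * (n - k) - binary_ones (n - k) < q"
proof (rule ccontr)
  assume q: "\<not> ?thesis"
  have "0 < binary_ones (n - k)" using nk by (intro binary_ones_pos) simp
  then have "q + 2 \<le> n" using q nk by linarith
  moreover have "accomplishes unconstrained_spies {{1..n} - {x} | x. x \<in> {2..n} - {}} (is_identity_of 1) t q"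
  proof (rule accomplishes_mono[OF t(2) _ order_refl])
    show "{{1..n} - {x} | x. x \<in> {2..n} - {}} \<subseteq> situations_with_spy n k"
    proof
      fix A assume "A \<in> {{1..n} - {x} | x. x \<in> {2..n} - {}}"
      then obtain x where "x \<in> {2..n}" "A = {1..n} - {x}" by blast
      then have x: "x \<in> {1..n}" "A = {1..n} - {x}" by auto
      then have "card A = n - 1" by (simp add: card_Diff_subset)
      then show "A \<in> situations_with_spy n k"
        using x nk situations_with_spy_iff[of A n k] by fastforce
    qed
  qed
  ultimately have full: "r \<and> m \<le> q" if "run lying_spies {1..n} t r m" for r m
    using that by (intro all_no_imp_knight[OF t(1), where Y = "{}" and q = q]) simp_all
  have "accomplishes lying_spies (situations n k) (is_identity_of 1) t q"
    unfolding accomplishes_def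
  proof (intro ballI allI impI)
    fix A r m assume A: "A \<in> situations n k" and run: "run lying_spies A t r m"
    show "is_identity_of 1 A r \<and> m \<le> q"
    proof (cases "A = {1..n}")
      case True
      then show ?thesis using full run nk by (auto simp: is_identity_of_def)
    next
      case False
      then have "A \<in> situations_with_spy n k"
        using A by (auto simp: situations_with_spy_def situations_def)
      then show ?thesis
        using accomplishes_unconstrained_imp_lying[OF t(2)] run unfolding accomplishes_def by blast
    qed
  qed
  then show False using nominee_lower_bound_lying[OF nk t(1)] q by blast
qed

section \<open>Combining the bounds\<close>

lemma situations_with_spy_subset: "situations_with_spy n k \<subseteq> situations n k"
  by (auto simp: situations_with_spy_def)

text \<open>Unconstrained spies without the promise are the hardest of the four settings, lying
  spies with it the easiest; matching bounds at these extremes settle all four.\<close>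

lemma questions_needed_eqI:
  assumes "\<exists>t. permitted n t \<and> accomplishes unconstrained_spies (situations n k) correct t v"
    and "\<And>t q. permitted n t \<Longrightarrow> accomplishes lying_spies (situations_with_spy n k) correct t q \<Longrightarrow> v \<le> q"
    and "\<Omega> \<in> {situations n k, situations_with_spy n k}" "M \<in> {lying_spies, unconstrained_spies}"
  shows "questions_needed n M \<Omega> correct = enat v"
proof (rule antisym)
  obtain t where t: "permitted n t" "accomplishes unconstrained_spies (situations n k) correct t v"
    using assms(1) by blast
  have "accomplishes unconstrained_spies \<Omega> correct t v"
    by (rule accomplishes_mono[OF t(2)]) (use assms(3) situations_with_spy_subset in auto)
  then have "accomplishes M \<Omega> correct t v"
    using assms(4) accomplishes_unconstrained_imp_lying by blast
  then show "questions_needed n M \<Omega> correct \<le> enat v"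
    by (rule questions_needed_le[OF t(1)])
  show "enat v \<le> questions_needed n M \<Omega> correct"
  proof (rule questions_needed_ge)
    fix s q assume s: "permitted n s" "accomplishes M \<Omega> correct s q"
    then have "accomplishes lying_spies \<Omega> correct s q"
      using assms(4) accomplishes_unconstrained_imp_lying by blast
    then have "accomplishes lying_spies (situations_with_spy n k) correct s q"
      by (rule accomplishes_mono) (use assms(3) situations_with_spy_subset in auto)
    then show "v \<le> q" using s(1) assms(2) by blast
  qed
qed

theorem theorem3:
  fixes n k :: nat
  assumes "n < 2 * k" and "k < n"
  shows "let v = 2 * (n - k) - binary_ones (n - k) in
      (K_S n k = enat v \<and> K_L n k = enat v \<and> E_S n k = enat v \<and> E_L n k = enat v) \<and>
      (K_S_tilde n k = enat v \<and> K_L_tilde n k = enat v \<and>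
       E_S_tilde n k = enat v \<and> E_L_tilde n k = enat v) \<and>
      (N_S n k = enat (v + 1) \<and> N_L n k = enat (v + 1) \<and> N_S_tilde n k = enat (v + 1) \<and>
       N_L_tilde n k =
         (if \<exists>e::nat. n = 2 ^ (e + 1) + 1 \<and> k = 2 ^ e + 1 then enat v else enat (v + 1)))"
proof -
  define v where "v = 2 * (n - k) - binary_ones (n - k)"
  have K: "questions_needed n M \<Omega> is_knight = enat v"
    if "\<Omega> \<in> {situations n k, situations_with_spy n k}" "M \<in> {lying_spies, unconstrained_spies}" for M \<Omega>
    unfolding v_def
  proof (rule questions_needed_eqI[OF _ _ that])
    show "\<exists>t. permitted n t \<and> accomplishes unconstrained_spies (situations n k) is_knight t
        (2 * (n - k) - binary_ones (n - k))"
      using knight_strategy[OF assms, of is_knight id] by (simp add: is_knight_def)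
    show "2 * (n - k) - binary_ones (n - k) \<le> q"
      if "permitted n t" "accomplishes lying_spies (situations_with_spy n k) is_knight t q" for t q
      using that
      by (rule identity_lower_bound[OF assms, where g = "\<lambda>x. (x, True)", rotated])
         (auto simp: is_knight_def is_identity_def)
  qed
  have E: "questions_needed n M \<Omega> (is_identity n) = enat v"
    if "\<Omega> \<in> {situations n k, situations_with_spy n k}" "M \<in> {lying_spies, unconstrained_spies}" for M \<Omega>
    unfolding v_def
  proof (rule questions_needed_eqI[OF _ _ that])
    show "\<exists>t. permitted n t \<and> accomplishes unconstrained_spies (situations n k) (is_identity n) t
        (2 * (n - k) - binary_ones (n - k))"
      by (rule knight_strategy[OF assms, where f = "\<lambda>x. (x, True)"]) (auto simp: is_identity_def)
    show "2 * (n - k) - binary_ones (n - k) \<le> q"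
      if "permitted n t" "accomplishes lying_spies (situations_with_spy n k) (is_identity n) t q" for t q
      using that by (rule identity_lower_bound[OF assms, where g = id, rotated]) auto
  qed
  obtain t where t: "permitted n t"
    "accomplishes unconstrained_spies (situations n k) (is_identity_of 1) t (v + 1)"
    using nominee_strategy[OF assms] unfolding v_def by blast
  note t' = t(2) accomplishes_unconstrained_imp_lying[OF t(2)]
  note N_upper = t'[THEN questions_needed_le[OF t(1)]]
    t'[THEN accomplishes_mono[OF _ situations_with_spy_subset order_refl], THEN questions_needed_le[OF t(1)]]
  have N_S: "N_S n k = enat (v + 1)"
    unfolding N_S_def
    using nominee_lower_bound_lying[OF assms] accomplishes_unconstrained_imp_lying
    by (intro antisym N_upper questions_needed_ge) (fastforce simp: v_def Suc_le_eq)
  have N_L: "N_L n k = enat (v + 1)"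
    unfolding N_L_def using nominee_lower_bound_lying[OF assms]
    by (intro antisym N_upper questions_needed_ge) (fastforce simp: v_def Suc_le_eq)
  have N_S_tilde: "N_S_tilde n k = enat (v + 1)"
    unfolding N_S_tilde_def using nominee_lower_bound_unconstrained_with_spy[OF assms]
    by (intro antisym N_upper questions_needed_ge) (fastforce simp: v_def Suc_le_eq)
  have N_L_tilde: "N_L_tilde n k = enat (v + 1)"
    if "\<not> (\<exists>e. n = 2 ^ (e + 1) + 1 \<and> k = 2 ^ e + 1)"
    unfolding N_L_tilde_def using nominee_lower_bound_lying_with_spy[OF assms _ _ that]
    by (intro antisym N_upper questions_needed_ge) (fastforce simp: v_def Suc_le_eq)
  have N_L_tilde_exceptional: "N_L_tilde n k = enat v"
    if "\<exists>e. n = 2 ^ (e + 1) + 1 \<and> k = 2 ^ e + 1"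
  proof (rule antisym)
    show "N_L_tilde n k \<le> enat v"
      unfolding N_L_tilde_def v_def using that exceptional_strategy questions_needed_le by blast
    \<comment> \<open>Identifying Person 1 determines somebody's identity, so the weaker bound still
      applies.\<close>
    show "enat v \<le> N_L_tilde n k"
      unfolding N_L_tilde_def v_def
    proof (rule questions_needed_ge)
      fix s q
      assume "permitted n s" "accomplishes lying_spies (situations_with_spy n k) (is_identity_of 1) s q"
      then show "2 * (n - k) - binary_ones (n - k) \<le> q"
        by (rule identity_lower_bound[OF assms, where g = "Pair 1", rotated])
           (use assms in \<open>auto simp: is_identity_def is_identity_of_def\<close>)
    qed
  qed
  show ?thesis
    unfolding Let_def v_def[symmetric]
    by (auto simp: K_S_def K_L_def E_S_def E_L_def K_S_tilde_def K_L_tilde_def E_S_tilde_def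
        E_L_tilde_def K E N_S N_L N_S_tilde N_L_tilde N_L_tilde_exceptional
        intro: N_L_tilde N_L_tilde_exceptional)
qed

end
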